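(* Let $K$ be a field with $\operatorname{char} K \neq 2$, let $E$ be an elliptic curve defined over $K$, and let $P \in E(K)$ be a non-torsion point. Suppose that $P$ is magnified by doubling a point, i.e. there exist a finite extension $L/K$ with $[L:K] < 4$ and a point $R \in E(L)$ with $2R = P$. Then $P$ is $K$-magnified, i.e. there exist an elliptic curve $E'$ defined over $K$, an isogeny $\phi: E' \to E$ defined over $K$ with $\deg \phi > 1$, and a point $Q \in E'(K)$ with $\phi(Q) = P$.
   Context: Definition (paper's): for a field $K$, an elliptic curve $E/K$, a point $P\in E(K)$ and an isogeny $\phi:E'\to E$, $P$ is called magnified (by $\phi$) if $E'$, $\phi$ and some point of $\phi^{-1}(P)$ are all defined over a finite extension $L/K$ with $[L:K]<\deg\phi$; it is called $K$-magnified if this holds with $L=K$. "Magnified by doubling a point" means magnified with $\phi$ the multiplication-by-$2$ map $E\to E$ (of degree $4$). *)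

theory Defs
  imports
    "HOL-Algebra.Algebraic_Closure_Type"
    "HOL-Algebra.Generated_Fields"
    "HOL-Computational_Algebra.Computational_Algebra"
begin

section \<open>Degrees of field extensions\<close>

text \<open>
  Field extensions are pairs of subfields of a field given by a type. The value \<open>0\<close> stands for
  an infinite degree; a finite degree is never \<open>0\<close>.
\<close>

definition extension_degree :: "'a::field set \<Rightarrow> 'a set \<Rightarrow> nat" where
  "extension_degree F L =
     (if ring.finite_dimension ring_of_type_algebra F L
      then ring.dim ring_of_type_algebra F L else 0)"

definition finite_field_extension :: "'a::field set \<Rightarrow> 'a set \<Rightarrow> bool" where
  "finite_field_extension F L \<longleftrightarrow>
     subfield F ring_of_type_algebra \<and> subfield L ring_of_type_algebra \<and> F \<subseteq> L \<and>
     ring.finite_dimension ring_of_type_algebra F L"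


section \<open>Elliptic curves and their group law\<close>

text \<open>
  \<open>Weierstrass a1 a2 a3 a4 a6\<close> is the projective plane curve with affine equation
  \<open>y\<^sup>2 + a1 x y + a3 y = x\<^sup>3 + a2 x\<^sup>2 + a4 x + a6\<close>. The base change of a curve or a point along a
  field embedding \<open>\<iota>\<close> is \<open>map_curve \<iota>\<close> or \<open>map_point \<iota>\<close>.
\<close>

datatype 'a curve = Weierstrass 'a 'a 'a 'a 'a

datatype 'a point = Infinity | Affine 'a 'a

fun discriminant :: "'a::field curve \<Rightarrow> 'a" where
  "discriminant (Weierstrass a1 a2 a3 a4 a6) =
     (let b2 = a1\<^sup>2 + 4 * a2;
          b4 = 2 * a4 + a1 * a3;
          b6 = a3\<^sup>2 + 4 * a6;
          b8 = a1\<^sup>2 * a6 + 4 * a2 * a6 - a1 * a3 * a4 + a2 * a3\<^sup>2 - a4\<^sup>2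
      in - b2\<^sup>2 * b8 - 8 * b4 ^ 3 - 27 * b6\<^sup>2 + 9 * b2 * b4 * b6)"

definition elliptic_curve :: "'a::field curve \<Rightarrow> bool" where
  "elliptic_curve E \<longleftrightarrow> discriminant E \<noteq> 0"

fun on_curve :: "'a::field curve \<Rightarrow> 'a point \<Rightarrow> bool" where
  "on_curve E Infinity \<longleftrightarrow> True"
| "on_curve (Weierstrass a1 a2 a3 a4 a6) (Affine x y) \<longleftrightarrow>
     y\<^sup>2 + a1 * x * y + a3 * y = x ^ 3 + a2 * x\<^sup>2 + a4 * x + a6"

definition points_over :: "'a::field curve \<Rightarrow> 'a set \<Rightarrow> 'a point set" where
  "points_over E L = {P. on_curve E P \<and> set_point P \<subseteq> L}"

fun point_add :: "'a::field curve \<Rightarrow> 'a point \<Rightarrow> 'a point \<Rightarrow> 'a point" where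
  "point_add E Infinity Q = Q"
| "point_add E P Infinity = P"
| "point_add (Weierstrass a1 a2 a3 a4 a6) (Affine x1 y1) (Affine x2 y2) =
     (if x1 = x2 \<and> y1 + y2 + a1 * x2 + a3 = 0 then Infinity
      else let m = (if x1 = x2
                    then (3 * x1\<^sup>2 + 2 * a2 * x1 + a4 - a1 * y1) / (2 * y1 + a1 * x1 + a3)
                    else (y2 - y1) / (x2 - x1));
               x3 = m\<^sup>2 + a1 * m - a2 - x1 - x2
           in Affine x3 (- (y1 + m * (x3 - x1)) - a1 * x3 - a3))"

definition point_mult :: "'a::field curve \<Rightarrow> nat \<Rightarrow> 'a point \<Rightarrow> 'a point" where
  "point_mult E n P = (point_add E P ^^ n) Infinity"

definition torsion_point :: "'a::field curve \<Rightarrow> 'a point \<Rightarrow> bool" where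
  "torsion_point E P \<longleftrightarrow> (\<exists>n>0. point_mult E n P = Infinity)"


section \<open>Function fields\<close>

text \<open>
  The function field of a curve \<open>E\<close> over \<open>K\<close> is realised as the subfield \<open>K(x, y)\<close> of a fixed
  algebraic closure of the rational function field \<open>K(x)\<close>, where \<open>y\<close> is a root of the Weierstrass
  equation. This equation is irreducible over \<open>K(x)\<close>, and its other root lies in the same field,
  so the choice of \<open>y\<close> is immaterial.
\<close>

type_synonym 'k ambient = "'k poly fract alg_closure"

definition const_fn :: "'k::field \<Rightarrow> 'k ambient" where
  "const_fn c = to_ac (Fract [:c:] 1)"

definition x_fn :: "'k::field ambient" where
  "x_fn = to_ac (Fract [:0, 1:] 1)"

definition y_fn :: "'k::field curve \<Rightarrow> 'k ambient" where
  "y_fn E = (SOME y. on_curve (map_curve const_fn E) (Affine x_fn y))"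

lemma y_fn_on_curve: "on_curve (map_curve const_fn E) (Affine x_fn (y_fn E))"
proof -
  obtain a1 a2 a3 a4 a6 where E: "map_curve const_fn E = Weierstrass a1 a2 a3 a4 a6"
    using curve.exhaust by blast
  define c where "c = x_fn ^ 3 + a2 * x_fn\<^sup>2 + a4 * x_fn + a6"
  have "\<exists>y. poly [:- c, a1 * x_fn + a3, 1:] y = 0"
    by (rule alg_closed_imp_poly_has_root) auto
  then obtain y where "poly [:- c, a1 * x_fn + a3, 1:] y = 0" ..
  hence "on_curve (map_curve const_fn E) (Affine x_fn y)"
    by (simp add: E c_def algebra_simps power2_eq_square)
  thus ?thesis
    unfolding y_fn_def by (rule someI)
qed

definition function_field :: "'k::field curve \<Rightarrow> 'k ambient set" where
  "function_field E = generate_field ring_of_type_algebra (range const_fn \<union> {x_fn, y_fn E})"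


section \<open>Morphisms and isogenies\<close>

definition eval2 :: "('k::field \<Rightarrow> 'b::field) \<Rightarrow> 'k poly poly \<Rightarrow> 'b \<times> 'b \<Rightarrow> 'b" where
  "eval2 \<iota> p = (\<lambda>(u, v). poly (map_poly (\<lambda>q. poly (map_poly \<iota> q) u) p) v)"

text \<open>
  Affine coordinates around a geometric point \<open>Q\<close>, as functions and as their values at \<open>Q\<close>:
  \<open>(x, y)\<close> away from infinity, and \<open>(x/y, 1/y)\<close> at infinity.
\<close>

fun chart :: "'k::field curve \<Rightarrow> 'k alg_closure point \<Rightarrow> 'k ambient \<times> 'k ambient" where
  "chart E (Affine x y) = (x_fn, y_fn E)"
| "chart E Infinity = (x_fn / y_fn E, 1 / y_fn E)"

fun chart_value :: "'a::field point \<Rightarrow> 'a \<times> 'a" where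
  "chart_value (Affine x y) = (x, y)"
| "chart_value Infinity = (0, 0)"

text \<open>\<open>f\<close> lies in the local ring of \<open>E\<close> at \<open>Q\<close> and takes the value \<open>c\<close> there.\<close>

definition has_value_at ::
    "'k::field curve \<Rightarrow> 'k ambient \<Rightarrow> 'k alg_closure point \<Rightarrow> 'k alg_closure \<Rightarrow> bool" where
  "has_value_at E f Q c \<longleftrightarrow>
     (\<exists>g h. eval2 to_ac h (chart_value Q) \<noteq> 0 \<and>
            f = eval2 const_fn g (chart E Q) / eval2 const_fn h (chart E Q) \<and>
            c = eval2 to_ac g (chart_value Q) / eval2 to_ac h (chart_value Q))"

fun proj_coords :: "'a::field point \<Rightarrow> 'a \<times> 'a \<times> 'a" where
  "proj_coords (Affine x y) = (x, y, 1)"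
| "proj_coords Infinity = (0, 1, 0)"

text \<open>
  A rational map from \<open>E'\<close> to \<open>E\<close> over \<open>K\<close> is a point of \<open>E\<close> over the function field of \<open>E'\<close>. It is
  regular at \<open>Q\<close> with image \<open>P\<close> if its homogeneous coordinates can be multiplied by a function \<open>t\<close>
  so that they become regular at \<open>Q\<close>, with values there that are homogeneous coordinates of \<open>P\<close>.
\<close>

definition rational_map :: "'k::field curve \<Rightarrow> 'k curve \<Rightarrow> 'k ambient point \<Rightarrow> bool" where
  "rational_map E' E \<phi> \<longleftrightarrow> \<phi> \<in> points_over (map_curve const_fn E) (function_field E')"

definition maps_to ::
    "'k::field curve \<Rightarrow> 'k ambient point \<Rightarrow> 'k alg_closure point \<Rightarrow> 'k alg_closure point \<Rightarrow> bool"
  where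
  "maps_to E' \<phi> Q P \<longleftrightarrow>
     (\<exists>t\<in>function_field E'. \<exists>s. s \<noteq> 0 \<and>
        (case (proj_coords \<phi>, proj_coords P) of ((f, g, h), (u, v, w)) \<Rightarrow>
           has_value_at E' (t * f) Q (s * u) \<and>
           has_value_at E' (t * g) Q (s * v) \<and>
           has_value_at E' (t * h) Q (s * w)))"

definition morphism :: "'k::field curve \<Rightarrow> 'k curve \<Rightarrow> 'k ambient point \<Rightarrow> bool" where
  "morphism E' E \<phi> \<longleftrightarrow> rational_map E' E \<phi> \<and>
     (\<forall>Q. on_curve (map_curve to_ac E') Q \<longrightarrow>
        (\<exists>P. on_curve (map_curve to_ac E) P \<and> maps_to E' \<phi> Q P))"

definition isogeny :: "'k::field curve \<Rightarrow> 'k curve \<Rightarrow> 'k ambient point \<Rightarrow> bool" where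
  "isogeny E' E \<phi> \<longleftrightarrow> morphism E' E \<phi> \<and> \<phi> \<notin> range (map_point const_fn) \<and>
     maps_to E' \<phi> Infinity Infinity"

text \<open>For a nonconstant \<open>\<phi> = (X, Y)\<close>, the pullback of the function field of the target is \<open>K(X, Y)\<close>.\<close>

definition isogeny_degree :: "'k::field curve \<Rightarrow> 'k ambient point \<Rightarrow> nat" where
  "isogeny_degree E' \<phi> =
     extension_degree (generate_field ring_of_type_algebra (range const_fn \<union> set_point \<phi>))
       (function_field E')"


section \<open>Magnified points\<close>

text \<open>Finite extensions of \<open>K\<close> are taken inside an algebraic closure of \<open>K\<close>.\<close>

definition magnified_by_doubling :: "'k::field curve \<Rightarrow> 'k point \<Rightarrow> bool" where
  "magnified_by_doubling E P \<longleftrightarrow>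
     (\<exists>L. finite_field_extension (range to_ac) L \<and> extension_degree (range to_ac) L < 4 \<and>
        (\<exists>R\<in>points_over (map_curve to_ac E) L.
           point_add (map_curve to_ac E) R R = map_point to_ac P))"

definition K_magnified :: "'k::field curve \<Rightarrow> 'k point \<Rightarrow> bool" where
  "K_magnified E P \<longleftrightarrow>
     (\<exists>E' \<phi> Q. elliptic_curve E' \<and> isogeny E' E \<phi> \<and> isogeny_degree E' \<phi> > 1 \<and>
        on_curve E' Q \<and> maps_to E' \<phi> (map_point to_ac Q) (map_point to_ac P))"

end

theory Submission
  imports Defs
begin

text \<open>
  Move \<open>P\<close> to \<open>(0, v)\<close> on \<open>Y\<^sup>2 = X\<^sup>3 + a X\<^sup>2 + b X + v\<^sup>2\<close>. A half \<open>R\<close> of \<open>P\<close> is determined by the slope \<open>m\<close> of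
  the tangent at \<open>R\<close>, and these slopes are the roots of the quartic
  \<open>m\<^sup>4 - 2 a m\<^sup>2 - 8 v m + a\<^sup>2 - 4 b\<close>. If a root has degree less than 4 over \<open>K\<close>, the quartic is
  reducible. Either it has a root in \<open>K\<close>, and \<open>P\<close> is twice a point of \<open>E(K)\<close>, or it is a product
  \<open>(m\<^sup>2 + p m + s) (m\<^sup>2 - p m + t)\<close>. Then \<open>p \<noteq> 0\<close> because \<open>v \<noteq> 0\<close>, and \<open>-(p/2)\<^sup>2\<close> is the abscissa of a
  2-torsion point \<open>T\<close> over \<open>K\<close> for which \<open>x(P) - x(T)\<close> is a square. Hence \<open>P\<close> is in the image of
  \<open>E'(K)\<close> under the isogeny of degree 2 dual to \<open>E \<rightarrow> E / \<langle>T\<rangle>\<close>.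
\<close>

section \<open>Evaluation of polynomials along a ring homomorphism\<close>

text \<open>Evaluation at a fixed \<open>u\<close> is again a ring homomorphism, so it can be
  iterated: \<open>ev (ev h u) v\<close> is evaluation in two variables.\<close>

definition ev :: "('a::comm_ring_1 \<Rightarrow> 'b::comm_ring_1) \<Rightarrow> 'b \<Rightarrow> 'a poly \<Rightarrow> 'b" where
  "ev h u p = poly (map_poly h p) u"

locale comm_hom =
  fixes h :: "'a::comm_ring_1 \<Rightarrow> 'b::comm_ring_1"
  assumes hom_add [simp]: "h (x + y) = h x + h y"
    and hom_mult [simp]: "h (x * y) = h x * h y"
    and hom_1 [simp]: "h 1 = 1"
begin

lemma hom_0 [simp]: "h 0 = 0"
  using hom_add[of 0 0] by simp

lemma hom_minus [simp]: "h (- x) = - h x"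
  using hom_add[of x "- x"] by (simp add: eq_neg_iff_add_eq_0 add.commute)

lemma hom_diff [simp]: "h (x - y) = h x - h y"
  using hom_add[of x "- y"] by simp

lemma hom_power [simp]: "h (x ^ n) = h x ^ n"
  by (induction n) auto

lemma hom_of_nat [simp]: "h (of_nat n) = of_nat n"
  by (induction n) auto

lemma hom_numeral [simp]: "h (numeral n) = numeral n"
  using hom_of_nat[of "numeral n"] by simp

lemma ev_0 [simp]: "ev h u 0 = 0"
  by (simp add: ev_def)

lemma ev_pCons [simp]: "ev h u (pCons x p) = h x + u * ev h u p"
  by (simp add: ev_def map_poly_pCons)

lemma ev_add: "ev h u (p + q) = ev h u p + ev h u q"
  by (induction p q rule: poly_induct2) (auto simp: algebra_simps)

lemma ev_smult [simp]: "ev h u (smult x p) = h x * ev h u p"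
  by (induction p) (auto simp: algebra_simps)

lemma ev_mult: "ev h u (p * q) = ev h u p * ev h u q"
  by (induction p) (auto simp: algebra_simps ev_add)

lemma comm_hom_ev: "comm_hom (ev h u)"
  by unfold_locales (auto simp: ev_add ev_mult one_pCons)

end

lemma eval2_eq_ev: "eval2 \<iota> p (u, v) = ev (ev \<iota> u) v p"
  by (simp add: eval2_def ev_def[abs_def])

lemma poly_eq_ev: "poly p u = ev (\<lambda>x. x) u p"
  by (simp add: ev_def)

interpretation to_ac: comm_hom to_ac
  by unfold_locales auto

interpretation const_fn: comm_hom const_fn
  by unfold_locales (auto simp: const_fn_def one_pCons fract_expand mult.commute simp flip: to_ac_add to_ac_mult)

interpretation to_ac_ev: comm_hom "ev to_ac u" for u
  by (rule to_ac.comm_hom_ev)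

interpretation const_fn_ev: comm_hom "ev const_fn u" for u
  by (rule const_fn.comm_hom_ev)

interpretation to_ac_ev2: comm_hom "ev (ev to_ac u) v" for u v
  by (rule to_ac_ev.comm_hom_ev)

interpretation const_fn_ev2: comm_hom "ev (ev const_fn u) v" for u v
  by (rule const_fn_ev.comm_hom_ev)

lemma ev_to_ac: "ev to_ac (to_ac u) p = to_ac (poly p u)"
  by (induction p) auto

lemma ev_const_fn_x_fn: "ev const_fn x_fn p = to_ac (Fract p 1)"
proof (induction p)
  case (pCons a p)
  have "Fract (pCons a p) 1 = Fract [:a:] 1 + Fract [:0, 1:] 1 * Fract p 1"
    by simp
  hence "to_ac (Fract (pCons a p) 1) = const_fn a + x_fn * to_ac (Fract p 1)"
    by (simp only: const_fn_def x_fn_def to_ac_add to_ac_mult)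
  thus ?case
    using pCons.IH by simp
qed (simp add: fract_collapse)

text \<open>\<open>x_fn\<close> is transcendental over the constants. Identities between functions
  of \<open>x\<close> can thus be read back as polynomial identities, where degrees can be
  compared.\<close>

lemma ev_const_fn_x_fn_inject: "ev const_fn x_fn p = ev const_fn x_fn q \<longleftrightarrow> p = q"
  by (simp add: ev_const_fn_x_fn eq_fract)

lemma ev_const_fn_x_fn_eq_0_iff: "ev const_fn x_fn p = 0 \<longleftrightarrow> p = 0"
  using ev_const_fn_x_fn_inject[of p 0] by simp

section \<open>Subfields of a field given by a type\<close>

lemma type_algebra_simps [simp]:
  "carrier ring_of_type_algebra = UNIV"
  "x \<otimes>\<^bsub>ring_of_type_algebra\<^esub> y = x * y"
  "x \<oplus>\<^bsub>ring_of_type_algebra\<^esub> y = x + y"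
  "\<one>\<^bsub>ring_of_type_algebra\<^esub> = 1"
  "\<zero>\<^bsub>ring_of_type_algebra\<^esub> = 0"
  by (simp_all add: ring_of_type_algebra_def)

lemma a_inv_type_algebra [simp]: "\<ominus>\<^bsub>ring_of_type_algebra\<^esub> x = - (x :: 'a::field)"
proof -
  interpret field "ring_of_type_algebra :: 'a ring" by rule
  show ?thesis using minus_equality[of "- x" x] by simp
qed

lemma m_inv_type_algebra [simp]:
  assumes "x \<noteq> 0"
  shows "inv\<^bsub>ring_of_type_algebra\<^esub> x = inverse (x :: 'a::field)"
proof -
  interpret field "ring_of_type_algebra :: 'a ring" by rule
  show ?thesis using comm_inv_char[of x "inverse x"] assms by simp
qed

lemma pow_type_algebra [simp]: "x [^]\<^bsub>ring_of_type_algebra\<^esub> (n::nat) = (x :: 'a::field) ^ n"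
proof -
  interpret field "ring_of_type_algebra :: 'a ring" by rule
  show ?thesis by (induction n) auto
qed

lemma subfield_type_algebraI:
  fixes S :: "'a::field set"
  assumes "1 \<in> S" "\<And>x y. x \<in> S \<Longrightarrow> y \<in> S \<Longrightarrow> x + y \<in> S" "\<And>x y. x \<in> S \<Longrightarrow> y \<in> S \<Longrightarrow> x * y \<in> S"
    "\<And>x. x \<in> S \<Longrightarrow> - x \<in> S" "\<And>x. x \<in> S \<Longrightarrow> inverse x \<in> S"
  shows "subfield S ring_of_type_algebra"
proof -
  interpret field "ring_of_type_algebra :: 'a ring" by rule
  show ?thesis
    by (rule subfieldI', rule subringI) (use assms in auto)
qed

lemma subfield_type_algebraD:
  fixes S :: "'a::field set"
  assumes "subfield S ring_of_type_algebra"
  shows "0 \<in> S" "1 \<in> S" "\<And>x y. x \<in> S \<Longrightarrow> y \<in> S \<Longrightarrow> x + y \<in> S" "\<And>x y. x \<in> S \<Longrightarrow> y \<in> S \<Longrightarrow> x * y \<in> S"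
    "\<And>x. x \<in> S \<Longrightarrow> - x \<in> S" "\<And>x. x \<in> S \<Longrightarrow> inverse x \<in> S"
    "\<And>x y. x \<in> S \<Longrightarrow> y \<in> S \<Longrightarrow> x - y \<in> S" "\<And>x y. x \<in> S \<Longrightarrow> y \<in> S \<Longrightarrow> x / y \<in> S"
    "\<And>x n. x \<in> S \<Longrightarrow> x ^ n \<in> S"
proof -
  interpret field "ring_of_type_algebra :: 'a ring" by rule
  note sr = subfieldE(1)[OF assms]
  show z: "0 \<in> S" and o: "1 \<in> S" using subringE(2,3)[OF sr] by auto
  show add: "x + y \<in> S" and mult: "x * y \<in> S" if "x \<in> S" "y \<in> S" for x y
    using subringE(6,7)[OF sr] that by auto
  show min: "- x \<in> S" if "x \<in> S" for x
    using subringE(5)[OF sr] that by auto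
  show inv: "inverse x \<in> S" if "x \<in> S" for x
    using subfield_m_inv(1)[OF assms, of x] that by (cases "x = 0") auto
  show "x - y \<in> S" if "x \<in> S" "y \<in> S" for x y
    using add[OF that(1) min[OF that(2)]] by simp
  show "x / y \<in> S" if "x \<in> S" "y \<in> S" for x y
    using mult[OF that(1) inv[OF that(2)]] by (simp add: field_simps)
  show "x ^ n \<in> S" if "x \<in> S" for x n
    by (induction n) (auto intro: o mult that)
qed

lemma subfield_generate_field:
  "subfield (generate_field ring_of_type_algebra H) (ring_of_type_algebra :: 'a::field ring)"
proof -
  interpret field "ring_of_type_algebra :: 'a ring" by rule
  show ?thesis by (rule generate_field_is_subfield) simp
qed

lemma generate_field_subset:
  assumes "subfield S (ring_of_type_algebra :: 'a::field ring)" "H \<subseteq> S"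
  shows "generate_field ring_of_type_algebra H \<subseteq> S"
proof -
  interpret field "ring_of_type_algebra :: 'a ring" by rule
  show ?thesis by (rule generate_field_min_subfield1) (use assms in auto)
qed

lemma (in comm_hom) ev_closed:
  fixes S :: "'b set"
  assumes "\<And>x y. x \<in> S \<Longrightarrow> y \<in> S \<Longrightarrow> x + y \<in> S" "\<And>x y. x \<in> S \<Longrightarrow> y \<in> S \<Longrightarrow> x * y \<in> S" "\<And>x. h x \<in> S" "u \<in> S"
  shows "ev h u p \<in> S"
proof (induction p)
  case 0
  show ?case using assms(3)[of 0] by simp
qed (use assms in auto)

section \<open>Finite extensions and their degrees\<close>

lemma eval_rev_coeffs:
  "ring.eval ring_of_type_algebra (rev (coeffs p)) x = poly p (x :: 'a::field)"
proof -
  interpret field "ring_of_type_algebra :: 'a ring" by rule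
  have app: "eval (xs @ [a]) x = eval xs x * x + a" for xs a
    by (induction xs) (auto simp: algebra_simps)
  show ?thesis
    by (induction p) (auto simp: app algebra_simps)
qed

text \<open>\<open>min\<close> forces \<open>L\<close> into the simple extension of \<open>F\<close>
  by \<open>x\<close>, which is finite-dimensional because \<open>x\<close> is a root of
  \<open>p\<close>.\<close>

lemma finite_dimension_if_simple:
  fixes F L :: "'a::field set"
  assumes F: "subfield F ring_of_type_algebra" and L: "subfield L ring_of_type_algebra" and "F \<subseteq> L"
    and p: "p \<noteq> 0" "set (coeffs p) \<subseteq> F" "poly p x = 0"
    and min: "\<And>S. subfield S ring_of_type_algebra \<Longrightarrow> F \<subseteq> S \<Longrightarrow> x \<in> S \<Longrightarrow> L \<subseteq> S"
  shows "ring.finite_dimension ring_of_type_algebra F L"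
proof -
  interpret field "ring_of_type_algebra :: 'a ring" by rule
  \<comment> \<open>Coefficient lists of univariate polynomials start with the leading coefficient,
    hence \<open>rev\<close> and this condition on \<open>hd\<close>.\<close>
  have "hd (rev (coeffs p)) \<noteq> 0"
    using p(1) by (simp add: hd_rev last_coeffs_eq_coeff_degree)
  hence "rev (coeffs p) \<in> carrier (F [X]\<^bsub>ring_of_type_algebra\<^esub>)"
    using p by (auto simp: univ_poly_def polynomial_def)
  hence alg: "(algebraic over F) x"
    by (rule algebraicI) (use p in \<open>auto simp: eval_rev_coeffs\<close>)
  let ?S = "simple_extension F x"
  have sub: "subfield ?S ring_of_type_algebra"
    using simple_extension_is_subfield[OF F] alg by auto
  have "F \<subseteq> ?S" by (rule simple_extension_incl) auto
  moreover have "x \<in> ?S" by (rule simple_extension_mem[OF subfieldE(1)[OF F]]) auto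
  ultimately have "L \<subseteq> ?S" by (rule min[OF sub])
  moreover have "finite_dimension F ?S"
    using finite_dimension_simple_extension[OF F] alg by auto
  moreover have "subalgebra F L ring_of_type_algebra"
    using subfield_type_algebraD(4)[OF L] \<open>F \<subseteq> L\<close> subring.axioms(1)[OF subfieldE(1)[OF L]]
    by (auto simp: subalgebra_def subalgebra_axioms_def)
  ultimately show ?thesis
    using subalbegra_incl_imp_finite_dimension[OF F] by blast
qed

text \<open>In dimension one, a basis of \<open>F\<close> over itself would already span
  \<open>L\<close>, giving \<open>L = F\<close>; dimension zero contradicts
  \<open>1 \<in> L\<close>. Finiteness rules out the value 0 that encodes an infinite
  degree.\<close>

lemma extension_degree_gt_1:
  fixes F L :: "'a::field set"
  assumes F: "subfield F ring_of_type_algebra" and L: "subfield L ring_of_type_algebra" and FL: "F \<subset> L"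
    and fin: "ring.finite_dimension ring_of_type_algebra F L"
  shows "extension_degree F L > 1"
proof -
  interpret field "ring_of_type_algebra :: 'a ring" by rule
  define n where "n = dim F L"
  have n: "dimension n F L"
    using finite_dimensionE[OF F fin] by (simp add: n_def over_def)
  have "n \<noteq> 0"
    using dimension_zero[OF F, of L] n subfield_type_algebraD(2)[OF L] by (cases n) auto
  moreover have "n \<noteq> 1"
  proof
    assume "n = 1"
    obtain Vs where Vs: "independent F Vs" "length Vs = 1" "Span F Vs = F"
      using exists_base[OF F dimension_one[OF F]] by auto
    hence "set Vs \<subseteq> L"
      using Span_base_incl[OF F, of Vs] FL by auto
    hence "Span F Vs = L"
      using independent_length_eq_dimension[OF F n Vs(1)] Vs(2) \<open>n = 1\<close> by auto
    thus False using Vs FL by auto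
  qed
  ultimately show ?thesis
    using fin by (simp add: extension_degree_def flip: n_def)
qed

text \<open>If \<open>n\<close> is the degree of the extension, the \<open>n + 1\<close> powers of
  \<open>m\<close> with exponents 0 to \<open>n\<close> are linearly dependent over the base
  field.\<close>

lemma annihilating_poly:
  fixes L :: "'k::field alg_closure set"
  assumes ext: "finite_field_extension (range to_ac) L" and m: "m \<in> L"
  obtains p where "p \<noteq> 0" "Polynomial.degree p \<le> extension_degree (range to_ac) L" "ev to_ac m p = 0"
proof -
  interpret field "ring_of_type_algebra :: 'k alg_closure ring" by rule
  let ?K = "range to_ac :: 'k alg_closure set"
  have K: "subfield ?K ring_of_type_algebra" and L: "subfield L ring_of_type_algebra"
    and fin: "finite_dimension ?K L"
    using ext by (auto simp: finite_field_extension_def)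
  define n where "n = extension_degree ?K L"
  have n: "dimension n ?K L"
    using finite_dimensionE[OF K fin] fin by (simp add: n_def over_def extension_degree_def)
  \<comment> \<open>Powers are listed in descending order, so that the head of a coefficient list
    belongs to the top exponent and can be split off by induction.\<close>
  define Us where "Us = map (\<lambda>i. m ^ i) (rev [0..<Suc n])"
  have "set Us \<subseteq> L"
    using subfield_type_algebraD(9)[OF L m] by (auto simp: Us_def)
  hence "dependent ?K Us"
    using independent_length_le_dimension[OF K n, of Us] by (auto simp: Us_def)
  then obtain Ks where Ks: "length Ks = length Us" "combine Ks Us = 0" "set Ks \<subseteq> ?K" "set Ks \<noteq> {0}"
    using dependent_imp_non_trivial_combine[OF K, of Us] by auto
  \<comment> \<open>The equivalence carries nontriviality of the combination over to
    \<open>p \<noteq> 0\<close>. Inclusion in \<open>{0}\<close> instead of equality covers the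
    empty list.\<close>
  have comb: "\<exists>p. (p = 0 \<longleftrightarrow> set Ks \<subseteq> {0}) \<and> (\<forall>i\<ge>k. Polynomial.coeff p i = 0) \<and>
      ev to_ac m p = combine Ks (map (\<lambda>i. m ^ i) (rev [0..<k]))"
    if "length Ks = k" "set Ks \<subseteq> ?K" for Ks k
    using that
  proof (induction k arbitrary: Ks)
    case 0
    thus ?case by (intro exI[of _ 0]) auto
  next
    case (Suc k)
    then obtain c Ks' where Ks: "Ks = to_ac c # Ks'" and Ks': "length Ks' = k" "set Ks' \<subseteq> ?K"
      by (cases Ks) auto
    from Suc.IH[OF Ks'] obtain p where p: "p = 0 \<longleftrightarrow> set Ks' \<subseteq> {0}"
      "\<forall>i\<ge>k. Polynomial.coeff p i = 0" "ev to_ac m p = combine Ks' (map (\<lambda>i. m ^ i) (rev [0..<k]))"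
      by blast
    define q where "q = Polynomial.monom c k + p"
    have "Polynomial.coeff q k = c" using p(2) by (simp add: q_def)
    hence "q = 0 \<longleftrightarrow> c = 0 \<and> p = 0"
      by (cases "c = 0") (auto simp: q_def simp del: coeff_add)
    moreover have "ev to_ac m (Polynomial.monom c k) = to_ac c * m ^ k"
      by (induction k) (auto simp: monom_Suc monom_0)
    ultimately show ?case using p by (intro exI[of _ q]) (auto simp: Ks q_def)
  qed
  obtain p where p: "p = 0 \<longleftrightarrow> set Ks \<subseteq> {0}" "\<forall>i\<ge>Suc n. Polynomial.coeff p i = 0"
    "ev to_ac m p = combine Ks Us"
    using comb[of Ks "Suc n"] Ks by (auto simp: Us_def)
  have "set Ks \<noteq> {}" using Ks(1) by (auto simp: Us_def)
  hence "p \<noteq> 0" using p(1) Ks(4) by (simp add: subset_singleton_iff)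
  moreover have "Polynomial.degree p \<le> n" using p(2) by (intro degree_le) auto
  ultimately show thesis using p Ks(2) that by (auto simp: n_def)
qed

section \<open>Values of functions at points\<close>

text \<open>
  Unlike \<open>has_value_at\<close>, this asks for a denominator that is nonzero as a function. That makes
  the closure properties independent of the irreducibility of the Weierstrass equation.
\<close>

definition regular_value ::
    "'k::field curve \<Rightarrow> 'k ambient \<Rightarrow> 'k alg_closure point \<Rightarrow> 'k alg_closure \<Rightarrow> bool" where
  "regular_value E f Q c \<longleftrightarrow>
     (\<exists>g h. eval2 to_ac h (chart_value Q) \<noteq> 0 \<and> eval2 const_fn h (chart E Q) \<noteq> 0 \<and>
            f = eval2 const_fn g (chart E Q) / eval2 const_fn h (chart E Q) \<and>
            c = eval2 to_ac g (chart_value Q) / eval2 to_ac h (chart_value Q))"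

lemma regular_value_imp_has_value_at: "regular_value E f Q c \<Longrightarrow> has_value_at E f Q c"
  unfolding regular_value_def has_value_at_def by blast

lemma eval2_to_ac_simps [simp]:
  "eval2 to_ac (p + q) w = eval2 to_ac p w + eval2 to_ac q w"
  "eval2 to_ac (p * q) w = eval2 to_ac p w * eval2 to_ac q w"
  "eval2 to_ac 1 w = 1"
  by (cases w; simp add: eval2_eq_ev)+

lemma eval2_const_fn_simps [simp]:
  "eval2 const_fn (p + q) w = eval2 const_fn p w + eval2 const_fn q w"
  "eval2 const_fn (p * q) w = eval2 const_fn p w * eval2 const_fn q w"
  "eval2 const_fn 1 w = 1"
  by (cases w; simp add: eval2_eq_ev)+

context
  fixes E :: "'k::field curve" and Q :: "'k alg_closure point"
begin

lemma regular_value_of_poly: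
  "regular_value E (eval2 const_fn g (chart E Q)) Q (eval2 to_ac g (chart_value Q))"
  unfolding regular_value_def by (intro exI[of _ g] exI[of _ 1]) simp

lemma regular_value_const: "regular_value E (const_fn c) Q (to_ac c)"
  using regular_value_of_poly[of "[:[:c:]:]"]
  by (cases "chart E Q"; cases "chart_value Q") (simp add: eval2_eq_ev)

lemma regular_value_fst: "regular_value E (fst (chart E Q)) Q (fst (chart_value Q))"
  using regular_value_of_poly[of "[:[:0, 1:]:]"]
  by (cases "chart E Q"; cases "chart_value Q") (simp add: eval2_eq_ev)

lemma regular_value_snd: "regular_value E (snd (chart E Q)) Q (snd (chart_value Q))"
  using regular_value_of_poly[of "[:0, 1:]"]
  by (cases "chart E Q"; cases "chart_value Q") (simp add: eval2_eq_ev)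

lemma regular_value_add:
  assumes "regular_value E f Q c" "regular_value E f' Q c'"
  shows "regular_value E (f + f') Q (c + c')"
proof -
  obtain g h where 1: "eval2 to_ac h (chart_value Q) \<noteq> 0" "eval2 const_fn h (chart E Q) \<noteq> 0"
    "f = eval2 const_fn g (chart E Q) / eval2 const_fn h (chart E Q)"
    "c = eval2 to_ac g (chart_value Q) / eval2 to_ac h (chart_value Q)"
    using assms(1) unfolding regular_value_def by blast
  obtain g' h' where 2: "eval2 to_ac h' (chart_value Q) \<noteq> 0" "eval2 const_fn h' (chart E Q) \<noteq> 0"
    "f' = eval2 const_fn g' (chart E Q) / eval2 const_fn h' (chart E Q)"
    "c' = eval2 to_ac g' (chart_value Q) / eval2 to_ac h' (chart_value Q)"
    using assms(2) unfolding regular_value_def by blast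
  show ?thesis
    unfolding regular_value_def
    by (intro exI[of _ "g * h' + g' * h"] exI[of _ "h * h'"]) (use 1 2 in \<open>simp add: add_frac_eq\<close>)
qed

lemma regular_value_mult:
  assumes "regular_value E f Q c" "regular_value E f' Q c'"
  shows "regular_value E (f * f') Q (c * c')"
proof -
  obtain g h where 1: "eval2 to_ac h (chart_value Q) \<noteq> 0" "eval2 const_fn h (chart E Q) \<noteq> 0"
    "f = eval2 const_fn g (chart E Q) / eval2 const_fn h (chart E Q)"
    "c = eval2 to_ac g (chart_value Q) / eval2 to_ac h (chart_value Q)"
    using assms(1) unfolding regular_value_def by blast
  obtain g' h' where 2: "eval2 to_ac h' (chart_value Q) \<noteq> 0" "eval2 const_fn h' (chart E Q) \<noteq> 0"
    "f' = eval2 const_fn g' (chart E Q) / eval2 const_fn h' (chart E Q)"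
    "c' = eval2 to_ac g' (chart_value Q) / eval2 to_ac h' (chart_value Q)"
    using assms(2) unfolding regular_value_def by blast
  show ?thesis
    unfolding regular_value_def
    by (intro exI[of _ "g * g'"] exI[of _ "h * h'"]) (use 1 2 in simp)
qed

text \<open>Numerator and denominator are exchanged; \<open>f \<noteq> 0\<close> and
  \<open>c \<noteq> 0\<close> give the two conditions on the new denominator.\<close>

lemma regular_value_inverse:
  assumes "regular_value E f Q c" "f \<noteq> 0" "c \<noteq> 0"
  shows "regular_value E (inverse f) Q (inverse c)"
proof -
  obtain g h where 1: "eval2 to_ac h (chart_value Q) \<noteq> 0" "eval2 const_fn h (chart E Q) \<noteq> 0"
    "f = eval2 const_fn g (chart E Q) / eval2 const_fn h (chart E Q)"
    "c = eval2 to_ac g (chart_value Q) / eval2 to_ac h (chart_value Q)"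
    using assms(1) unfolding regular_value_def by blast
  show ?thesis
    unfolding regular_value_def
    by (intro exI[of _ h] exI[of _ g]) (use 1 assms(2,3) in auto)
qed

lemma regular_value_divide:
  assumes "regular_value E f Q c" "regular_value E f' Q c'" "f' \<noteq> 0" "c' \<noteq> 0"
  shows "regular_value E (f / f') Q (c / c')"
  using regular_value_mult[OF assms(1) regular_value_inverse[OF assms(2-4)]]
  by (simp add: divide_inverse)

lemma regular_value_diff:
  assumes "regular_value E f Q c" "regular_value E f' Q c'"
  shows "regular_value E (f - f') Q (c - c')"
  using regular_value_add[OF assms(1) regular_value_mult[OF regular_value_const[of "-1"] assms(2)]]
  by simp

lemma regular_value_power:
  assumes "regular_value E f Q c"
  shows "regular_value E (f ^ n) Q (c ^ n)"
  using regular_value_const[of 1] by (induction n) (auto intro: regular_value_mult[OF assms])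

lemma regular_value_ev:
  assumes "regular_value E f Q c"
  shows "regular_value E (ev const_fn f p) Q (ev to_ac c p)"
  using regular_value_const[of 0]
  by (induction p) (auto intro!: regular_value_add regular_value_mult regular_value_const assms)

lemmas regular_value_intros =
  regular_value_add regular_value_diff regular_value_mult regular_value_power regular_value_ev
  regular_value_const

end

section \<open>Short Weierstrass equations\<close>

lemma on_curve_short:
  assumes "comm_hom \<iota>"
  shows "on_curve (map_curve \<iota> (Weierstrass 0 a 0 b c)) (Affine u v) \<longleftrightarrow> v\<^sup>2 = ev \<iota> u [:c, b, a, 1:]"
proof -
  interpret comm_hom \<iota> by fact
  show ?thesis by (simp add: algebra_simps power2_eq_square power3_eq_cube)
qed

locale short_curve =
  fixes a b c :: "'k::field"
begin

definition f where "f = [:c, b, a, 1:]"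
definition source where "source = Weierstrass 0 a 0 b c"

abbreviation x where "x \<equiv> x_fn :: 'k ambient"
definition y where "y = y_fn source"
abbreviation fn where "fn \<equiv> ev const_fn x"

lemma degree_f [simp]: "Polynomial.degree f = 3" and f_nonzero [simp]: "f \<noteq> 0"
  by (simp_all add: f_def)

lemma x_nonzero: "x \<noteq> 0"
  using ev_const_fn_x_fn_eq_0_iff[of "[:0, 1:]"] by simp

lemma y_squared: "y\<^sup>2 = fn f"
  using y_fn_on_curve[of source] on_curve_short[OF const_fn.comm_hom_axioms, of a b c x y]
  by (simp add: y_def source_def f_def)

lemma y_nonzero [simp]: "y \<noteq> 0"
  using y_squared by (auto simp: ev_const_fn_x_fn_eq_0_iff)

lemma subfield_function_field: "subfield (function_field source) ring_of_type_algebra"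
  unfolding function_field_def by (rule subfield_generate_field)

lemma function_field_base:
  "const_fn k \<in> function_field source" "x \<in> function_field source" "y \<in> function_field source"
  by (auto simp: function_field_def y_def intro: generate_field.incl)

lemma fn_in_function_field: "fn p \<in> function_field source"
  using subfield_type_algebraD[OF subfield_function_field] function_field_base
  by (intro const_fn.ev_closed) auto

text \<open>Squaring would give \<open>f * q\<^sup>2 = p\<^sup>2\<close>, with odd degree on the
  left because \<open>f\<close> is cubic and even degree on the right.\<close>

lemma y_not_rational:
  assumes "q \<noteq> 0"
  shows "y * fn q \<noteq> fn p"
proof
  assume "y * fn q = fn p"
  hence "y\<^sup>2 * fn q ^ 2 = fn p ^ 2" by (metis power_mult_distrib)
  hence "fn (f * q\<^sup>2) = fn (p\<^sup>2)" by (simp add: y_squared)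
  hence eq: "f * q\<^sup>2 = p\<^sup>2" by (simp only: ev_const_fn_x_fn_inject)
  hence "p \<noteq> 0" using assms by auto
  have "Polynomial.degree (f * q\<^sup>2) = 3 + 2 * Polynomial.degree q"
    using assms by (simp add: degree_mult_eq degree_power_eq)
  moreover have "Polynomial.degree (p\<^sup>2) = 2 * Polynomial.degree p"
    using \<open>p \<noteq> 0\<close> by (simp add: degree_power_eq)
  ultimately have "3 + 2 * Polynomial.degree q = 2 * Polynomial.degree p" using eq by simp
  thus False by presburger
qed

lemma regular_value_at_affine:
  "regular_value source x (Affine z w) z" "regular_value source y (Affine z w) w"
  using regular_value_fst[of source "Affine z w"] regular_value_snd[of source "Affine z w"]
  by (simp_all add: y_def)

text \<open>The first two are the chart coordinates. By the third, a polynomial in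
  \<open>1 / x\<close> takes its constant coefficient as value at infinity.\<close>

lemma regular_value_at_infinity:
  "regular_value source (x / y) Infinity 0" "regular_value source (1 / y) Infinity 0"
  "regular_value source (1 / x) Infinity 0"
proof -
  show z: "regular_value source (x / y) Infinity 0" and w: "regular_value source (1 / y) Infinity 0"
    using regular_value_fst[of source Infinity] regular_value_snd[of source Infinity]
    by (simp_all add: y_def)
  \<comment> \<open>In the coordinates \<open>z = x/y\<close>, \<open>w = 1/y\<close> the equation reads \<open>w u = z\<^sup>3\<close> with \<open>u\<close> a unit at infinity.\<close>
  define u where "u = 1 - const_fn a * (x / y)\<^sup>2 - const_fn b * (x / y * (1 / y)) - const_fn c * (1 / y)\<^sup>2"
  have "regular_value source (const_fn 1 - const_fn a * (x / y)\<^sup>2 - const_fn b * (x / y * (1 / y))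
      - const_fn c * (1 / y)\<^sup>2) Infinity (to_ac 1 - to_ac a * 0\<^sup>2 - to_ac b * (0 * 0) - to_ac c * 0\<^sup>2)"
    by (intro regular_value_intros z w)
  hence u: "regular_value source u Infinity 1" by (simp add: u_def)
  have "u * y\<^sup>2 = y\<^sup>2 - const_fn a * x\<^sup>2 - const_fn b * x - const_fn c"
    by (simp add: u_def field_simps power2_eq_square)
  also have "\<dots> = x ^ 3"
    using y_squared by (simp add: f_def algebra_simps power2_eq_square power3_eq_cube)
  finally have eq: "u * y\<^sup>2 = x ^ 3" .
  hence "u \<noteq> 0" using x_nonzero by auto
  have "(x / y)\<^sup>2 / u = 1 / x"
    using eq x_nonzero \<open>u \<noteq> 0\<close> by (simp add: field_simps power2_eq_square power3_eq_cube)
  thus "regular_value source (1 / x) Infinity 0"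
    using regular_value_divide[OF regular_value_power[OF z, of 2] u \<open>u \<noteq> 0\<close>] by simp
qed

end

section \<open>Isogenies onto a curve in general Weierstrass form\<close>

text \<open>
  The target is \<open>y\<^sup>2 + 2 h1 x y + 2 h3 y = x\<^sup>3 + a2 x\<^sup>2 + a4 x + a6\<close>. The substitution
  \<open>(X + e, Y - h1 (X + e) - h3)\<close> turns it into \<open>Y\<^sup>2 = X\<^sup>3 + A X\<^sup>2 + B X + C\<close>, and in these
  coordinates the isogeny is \<open>X = N(x) / D(x)\<close>, \<open>Y = y M(x) / D(x)\<^sup>2\<close>. The factor \<open>G = f / D\<close>
  serves to rewrite it near the zeros of \<open>D\<close> as \<open>X = N G / y\<^sup>2\<close>, \<open>Y = M G\<^sup>2 / y\<^sup>3\<close>.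
\<close>

locale isogeny_data = short_curve a b c for a b c :: "'k::field" +
  fixes h1 a2 h3 a4 a6 e A B C :: 'k and N D M G :: "'k poly"
  assumes A_eq: "A = a2 + h1\<^sup>2 + 3 * e"
    and B_eq: "B = a4 + 2 * h1 * h3 + 2 * e * (a2 + h1\<^sup>2) + 3 * e\<^sup>2"
    and C_eq: "C = a6 + h3\<^sup>2 + e * (a4 + 2 * h1 * h3) + e\<^sup>2 * (a2 + h1\<^sup>2) + e ^ 3"
    and factor_f: "[:c, b, a, 1:] = D * G"
    and curve_identity:
      "M\<^sup>2 * G = N ^ 3 + [:A:] * N\<^sup>2 * D + [:B:] * N * D\<^sup>2 + [:C:] * D ^ 3"
    and degree_D: "Polynomial.degree D > 0"
    and degree_N: "Polynomial.degree N = Polynomial.degree D + 1"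
    and degree_M: "Polynomial.degree M = 2 * Polynomial.degree D"
    and no_common_root: "\<And>z. ev to_ac z D = 0 \<Longrightarrow> ev to_ac z N \<noteq> 0"
begin

definition target where "target = Weierstrass (2 * h1) a2 (2 * h3) a4 a6"

text \<open>The embedding is a parameter because the same substitution is applied over the function
  field, over the algebraic closure and over the base field.\<close>

definition target_point :: "('k \<Rightarrow> 'b::field) \<Rightarrow> 'b \<Rightarrow> 'b \<Rightarrow> 'b point" where
  "target_point \<iota> u v = Affine (u + \<iota> e) (v - \<iota> h1 * (u + \<iota> e) - \<iota> h3)"

definition fX where "fX = fn N / fn D"
definition fY where "fY = y * fn M / (fn D)\<^sup>2"
definition \<phi> where "\<phi> = target_point const_fn fX fY"

lemma f_factor: "f = D * G"
  using factor_f by (simp add: f_def)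

lemma polys_nonzero [simp]: "D \<noteq> 0" "N \<noteq> 0" "M \<noteq> 0"
proof -
  show "D \<noteq> 0" "N \<noteq> 0" "M \<noteq> 0"
    using degree_D degree_N degree_M by auto
qed

lemma fn_nonzero [simp]: "fn D \<noteq> 0" "fn N \<noteq> 0" "fn M \<noteq> 0"
  by (simp_all add: ev_const_fn_x_fn_eq_0_iff)

lemma on_target:
  assumes "comm_hom \<iota>" and eq: "Y'\<^sup>2 = X' ^ 3 + \<iota> A * X'\<^sup>2 + \<iota> B * X' + \<iota> C"
  shows "on_curve (map_curve \<iota> target) (target_point \<iota> X' Y')"
proof -
  interpret comm_hom \<iota> by fact
  show ?thesis
    using eq unfolding target_def target_point_def A_eq B_eq C_eq
    by (simp add: algebra_simps power2_eq_square power3_eq_cube)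
qed

text \<open>Since \<open>v\<^sup>2\<close> is the value of \<open>D * G\<close>, the equation is
  \<open>curve_identity\<close> divided by \<open>D ^ 3\<close>. It serves both for the generic
  point and for geometric points.\<close>

lemma short_equation:
  fixes \<iota> :: "'k \<Rightarrow> 'b::field"
  assumes "comm_hom \<iota>" and v: "v\<^sup>2 = ev \<iota> u f" and D: "ev \<iota> u D \<noteq> 0"
  defines "X' \<equiv> ev \<iota> u N / ev \<iota> u D" and "Y' \<equiv> v * ev \<iota> u M / (ev \<iota> u D)\<^sup>2"
  shows "Y'\<^sup>2 = X' ^ 3 + \<iota> A * X'\<^sup>2 + \<iota> B * X' + \<iota> C"
proof -
  interpret comm_hom \<iota> by fact
  interpret E: comm_hom "ev \<iota> u" by (rule comm_hom_ev)
  define n d m g where "n = ev \<iota> u N" and "d = ev \<iota> u D" and "m = ev \<iota> u M" and "g = ev \<iota> u G"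
  have v2: "v\<^sup>2 = d * g" by (simp add: v f_factor d_def g_def)
  have "ev \<iota> u (M\<^sup>2 * G) = ev \<iota> u (N ^ 3 + [:A:] * N\<^sup>2 * D + [:B:] * N * D\<^sup>2 + [:C:] * D ^ 3)"
    by (simp only: curve_identity)
  hence id: "m\<^sup>2 * g = n ^ 3 + \<iota> A * n\<^sup>2 * d + \<iota> B * n * d\<^sup>2 + \<iota> C * d ^ 3"
    by (simp add: n_def d_def m_def g_def)
  have d: "d \<noteq> 0" using D by (simp add: d_def)
  have "Y'\<^sup>2 = v\<^sup>2 * m\<^sup>2 / d ^ 4"
    by (simp add: Y'_def m_def d_def power_divide power_mult_distrib flip: power_mult)
  also have "\<dots> = m\<^sup>2 * g / d ^ 3"
    using d unfolding v2 by (simp add: eval_nat_numeral)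
  also have "\<dots> = (n / d) ^ 3 + \<iota> A * (n / d)\<^sup>2 + \<iota> B * (n / d) + \<iota> C"
    unfolding id using d by (simp add: field_simps power2_eq_square power3_eq_cube)
  finally show ?thesis by (simp add: X'_def n_def d_def)
qed

lemma XY_equation: "fY\<^sup>2 = fX ^ 3 + const_fn A * fX\<^sup>2 + const_fn B * fX + const_fn C"
  unfolding fX_def fY_def
  by (rule short_equation[OF const_fn.comm_hom_axioms]) (auto simp: y_squared)

lemma XY_in_function_field: "fX \<in> function_field source" "fY \<in> function_field source"
  unfolding fX_def fY_def
  by (intro subfield_type_algebraD[OF subfield_function_field] fn_in_function_field function_field_base)+

lemma rational_map: "rational_map source target \<phi>"
  unfolding rational_map_def points_over_def
  using on_target[OF const_fn.comm_hom_axioms XY_equation]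
  by (auto simp: \<phi>_def target_point_def
      intro!: subfield_type_algebraD[OF subfield_function_field] XY_in_function_field function_field_base)

text \<open>The target coordinates are affine linear in \<open>fX\<close> and \<open>fY\<close>, so
  after multiplication by \<open>t\<close> their values follow from those of \<open>t\<close>,
  \<open>t * fX\<close> and \<open>t * fY\<close>.\<close>

lemma maps_toI:
  assumes t: "t \<in> function_field source" "regular_value source t Q k"
    and XY: "regular_value source (t * fX) Q u" "regular_value source (t * fY) Q v"
    and P: "s \<noteq> 0" "proj_coords P = (p, q, r)"
      "u + k * to_ac e = s * p" "v - to_ac h1 * (u + k * to_ac e) - k * to_ac h3 = s * q" "k = s * r"
  shows "maps_to source \<phi> Q P"
proof -
  have x: "regular_value source (t * fX + t * const_fn e) Q (s * p)"
    unfolding P(3)[symmetric] by (intro regular_value_intros t XY)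
  have y: "regular_value source (t * fY - const_fn h1 * (t * fX + t * const_fn e) - t * const_fn h3) Q (s * q)"
    unfolding P(4)[symmetric] by (intro regular_value_intros t XY)
  have "regular_value source (t * (fX + const_fn e)) Q (s * p)"
    "regular_value source (t * (fY - const_fn h1 * (fX + const_fn e) - const_fn h3)) Q (s * q)"
    using x y by (simp_all add: algebra_simps)
  thus ?thesis
    unfolding maps_to_def using t P
    by (intro bexI[OF _ t(1)] exI[of _ s])
      (auto simp: \<phi>_def target_point_def intro: regular_value_imp_has_value_at)
qed

lemma maps_to_affine:
  assumes D: "ev to_ac z D \<noteq> 0"
  shows "maps_to source \<phi> (Affine z w)
    (target_point to_ac (ev to_ac z N / ev to_ac z D) (w * ev to_ac z M / (ev to_ac z D)\<^sup>2))"
proof -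
  let ?Q = "Affine z w"
  have "regular_value source fX ?Q (ev to_ac z N / ev to_ac z D)"
    "regular_value source fY ?Q (w * ev to_ac z M / (ev to_ac z D)\<^sup>2)"
    unfolding fX_def fY_def using D
    by (auto intro!: regular_value_divide regular_value_intros regular_value_at_affine)
  thus ?thesis
    using regular_value_const[of source 1 ?Q] subfield_type_algebraD(2)[OF subfield_function_field]
    by (intro maps_toI[of 1 _ 1 _ _ 1]) (auto simp: target_point_def)
qed

text \<open>The factor \<open>y ^ 3\<close> clears the poles. As \<open>w = 0\<close>, only the
  middle coordinate \<open>M G\<^sup>2\<close> survives, and it is nonzero because
  \<open>curve_identity\<close> reduces to \<open>M\<^sup>2 G = N ^ 3\<close> at a zero of
  \<open>D\<close>.\<close>

lemma maps_to_pole: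
  assumes w: "w\<^sup>2 = ev to_ac z f" and D: "ev to_ac z D = 0"
  shows "maps_to source \<phi> (Affine z w) Infinity"
proof -
  let ?Q = "Affine z w"
  have w0: "w = 0" using w D by (simp add: f_factor)
  have "ev to_ac z (M\<^sup>2 * G) = ev to_ac z (N ^ 3 + [:A:] * N\<^sup>2 * D + [:B:] * N * D\<^sup>2 + [:C:] * D ^ 3)"
    by (simp only: curve_identity)
  hence "(ev to_ac z M)\<^sup>2 * ev to_ac z G = ev to_ac z N ^ 3" by (simp add: D)
  hence s: "ev to_ac z M * (ev to_ac z G)\<^sup>2 \<noteq> 0"
    using no_common_root[OF D] by auto
  have yy: "y * y = fn D * fn G"
    using y_squared by (simp add: f_factor power2_eq_square)
  have "y ^ 3 * fX = (y * y) * y * fn N / fn D"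
    by (simp add: fX_def power3_eq_cube)
  hence X: "y ^ 3 * fX = y * fn N * fn G"
    by (simp add: yy)
  have "y ^ 3 * fY = (y * y) * (y * y) * fn M / (fn D)\<^sup>2"
    by (simp add: fY_def power3_eq_cube)
  hence Y: "y ^ 3 * fY = fn M * (fn G)\<^sup>2"
    by (simp add: yy power2_eq_square)
  have "y ^ 3 \<in> function_field source"
    by (intro subfield_type_algebraD[OF subfield_function_field] function_field_base)
  moreover have "regular_value source (y ^ 3) ?Q (w ^ 3)"
    by (intro regular_value_intros regular_value_at_affine)
  moreover have "regular_value source (y ^ 3 * fX) ?Q (w * ev to_ac z N * ev to_ac z G)"
    unfolding X by (intro regular_value_intros regular_value_at_affine)
  moreover have "regular_value source (y ^ 3 * fY) ?Q (ev to_ac z M * (ev to_ac z G)\<^sup>2)"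
    unfolding Y by (intro regular_value_intros regular_value_at_affine)
  ultimately show ?thesis
    by (rule maps_toI[OF _ _ _ _ s]) (auto simp: w0)
qed

text \<open>\<open>q\<close> is \<open>p\<close> with its coefficients reversed. Its constant
  coefficient is what remains at infinity, where \<open>1 / x\<close> vanishes.\<close>

lemma fn_reversed:
  assumes "p \<noteq> 0"
  obtains q where "fn p = x ^ Polynomial.degree p * ev const_fn (1 / x) q"
    "Polynomial.coeff q 0 = Polynomial.lead_coeff p"
proof -
  have "\<exists>q. fn p = x ^ Polynomial.degree p * ev const_fn (1 / x) q \<and>
      Polynomial.coeff q 0 = Polynomial.lead_coeff p"
    using assms
  proof (induction p)
    case (pCons k p)
    show ?case
    proof (cases "p = 0")
      case True
      thus ?thesis by (intro exI[of _ "[:k:]"]) simp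
    next
      case False
      then obtain q where q: "fn p = x ^ Polynomial.degree p * ev const_fn (1 / x) q"
        "Polynomial.coeff q 0 = Polynomial.lead_coeff p"
        using pCons.IH by blast
      let ?n = "Suc (Polynomial.degree p)"
      have "x ^ i * ev const_fn (1 / x) (Polynomial.monom k i) = const_fn k" for i
        using x_nonzero by (induction i) (auto simp: monom_0 monom_Suc)
      from this[of ?n]
      have "fn (pCons k p) = x ^ ?n * ev const_fn (1 / x) (Polynomial.monom k ?n + q)"
        by (simp add: q(1) algebra_simps del: power_Suc) simp
      thus ?thesis
        using False q(2) by (intro exI[of _ "Polynomial.monom k ?n + q"]) simp
    qed
  qed simp
  thus thesis using that by blast
qed

text \<open>The factor is \<open>1 / y\<close>. By the degrees of \<open>N\<close>, \<open>D\<close>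
  and \<open>M\<close>, the first coordinate becomes \<open>x / y\<close> times a regular function
  and vanishes, while in the second all powers of \<open>x\<close> cancel and a nonzero value
  remains.\<close>

lemma maps_to_Infinity: "maps_to source \<phi> Infinity Infinity"
proof -
  have value0: "regular_value source (ev const_fn (1 / x) q) Infinity (to_ac (Polynomial.coeff q 0))" for q
    using regular_value_ev[OF regular_value_at_infinity(3), of q] by (cases q) auto
  let ?d = "Polynomial.degree D"
  obtain n where n: "fn N = x ^ (?d + 1) * ev const_fn (1 / x) n"
      "Polynomial.coeff n 0 = Polynomial.lead_coeff N"
    using fn_reversed[of N] degree_N by auto
  obtain d where d: "fn D = x ^ ?d * ev const_fn (1 / x) d"
      "Polynomial.coeff d 0 = Polynomial.lead_coeff D"
    using fn_reversed[of D] by auto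
  obtain m where m: "fn M = x ^ (2 * ?d) * ev const_fn (1 / x) m"
      "Polynomial.coeff m 0 = Polynomial.lead_coeff M"
    using fn_reversed[of M] degree_M by auto
  have d0: "ev const_fn (1 / x) d \<noteq> 0" using d(1) fn_nonzero(1) by auto
  have dc: "to_ac (Polynomial.coeff d 0) \<noteq> 0" by (simp add: d(2))
  have X: "1 / y * fX = x / y * (ev const_fn (1 / x) n / ev const_fn (1 / x) d)"
    using x_nonzero d0 by (simp add: fX_def n d)
  have Y: "1 / y * fY = ev const_fn (1 / x) m / (ev const_fn (1 / x) d)\<^sup>2"
    using x_nonzero d0 by (simp add: fY_def m d power_mult_distrib power_mult mult.commute)
  define s where "s = to_ac (Polynomial.coeff m 0) / (to_ac (Polynomial.coeff d 0))\<^sup>2"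
  have s: "s \<noteq> 0" using dc by (simp add: s_def m(2))
  have "1 / y \<in> function_field source"
    by (intro subfield_type_algebraD[OF subfield_function_field] function_field_base)
  moreover note regular_value_at_infinity(2)
  moreover have "regular_value source (1 / y * fX) Infinity
      (0 * (to_ac (Polynomial.coeff n 0) / to_ac (Polynomial.coeff d 0)))"
    unfolding X by (intro regular_value_mult regular_value_divide regular_value_at_infinity value0 d0 dc)
  moreover have "regular_value source (1 / y * fY) Infinity s"
    unfolding Y s_def using d0 dc
    by (intro regular_value_power regular_value_divide value0) auto
  ultimately show ?thesis
    by (rule maps_toI[OF _ _ _ _ s]) auto
qed

text \<open>If \<open>fX\<close> were constant, \<open>N\<close> would be a scalar multiple of
  \<open>D\<close>, but its degree is larger.\<close>

lemma not_constant: "\<phi> \<notin> range (map_point const_fn)"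
proof
  assume "\<phi> \<in> range (map_point const_fn)"
  then obtain P where P: "\<phi> = map_point const_fn P" by blast
  then obtain k where "fX + const_fn e = const_fn k"
    by (cases P) (auto simp: \<phi>_def target_point_def)
  hence "fX = const_fn (k - e)" by (simp add: algebra_simps)
  moreover have "fn N = fX * fn D" by (simp add: fX_def)
  ultimately have "fn N = fn ([:k - e:] * D)" by simp
  hence eq: "N = smult (k - e) D" by (simp only: ev_const_fn_x_fn_inject) simp
  show False
    using degree_N degree_smult_le[of "k - e" D] by (simp add: eq)
qed

theorem isogeny: "isogeny source target \<phi>"
  unfolding isogeny_def morphism_def
proof (intro conjI allI impI rational_map not_constant maps_to_Infinity)
  fix Q assume Q: "on_curve (map_curve to_ac source) Q"
  show "\<exists>P. on_curve (map_curve to_ac target) P \<and> maps_to source \<phi> Q P"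
  proof (cases Q)
    case Infinity
    thus ?thesis using maps_to_Infinity by (intro exI[of _ Infinity]) auto
  next
    case (Affine z w)
    have w: "w\<^sup>2 = ev to_ac z f"
      using Q on_curve_short[OF to_ac.comm_hom_axioms, of a b c z w]
      by (simp add: Affine source_def f_def)
    show ?thesis
    proof (cases "ev to_ac z D = 0")
      case True
      thus ?thesis
        using maps_to_pole[OF w] by (intro exI[of _ Infinity]) (auto simp: Affine)
    next
      case False
      show ?thesis
        using on_target[OF to_ac.comm_hom_axioms short_equation[OF to_ac.comm_hom_axioms w False]]
          maps_to_affine[OF False, of w]
        unfolding Affine by blast
    qed
  qed
qed

end

section \<open>The degree of the isogeny exceeds one\<close>

definition rational_in :: "'k::field ambient \<Rightarrow> 'k ambient set" where
  "rational_in u = {ev const_fn u p / ev const_fn u q | p q. ev const_fn u q \<noteq> 0}"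

lemma rational_inI: "ev const_fn u q \<noteq> 0 \<Longrightarrow> w = ev const_fn u p / ev const_fn u q \<Longrightarrow> w \<in> rational_in u"
  unfolding rational_in_def by blast

text \<open>So \<open>rational_in u\<close> is the field generated by \<open>u\<close> over the
  constants. Explicit quotients supply the polynomials whose degrees are compared later.\<close>

lemma subfield_rational_in: "subfield (rational_in u) ring_of_type_algebra"
proof (rule subfield_type_algebraI)
  show "1 \<in> rational_in u" by (rule rational_inI[of _ 1 _ 1]) auto
next
  fix v w assume "v \<in> rational_in u" "w \<in> rational_in u"
  then obtain p q p' q' where *: "ev const_fn u q \<noteq> 0" "v = ev const_fn u p / ev const_fn u q"
    "ev const_fn u q' \<noteq> 0" "w = ev const_fn u p' / ev const_fn u q'"
    unfolding rational_in_def by blast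
  show "v + w \<in> rational_in u"
    by (rule rational_inI[of _ "q * q'" _ "p * q' + p' * q"]) (use * in \<open>auto simp: add_frac_eq\<close>)
  show "v * w \<in> rational_in u"
    by (rule rational_inI[of _ "q * q'" _ "p * p'"]) (use * in auto)
next
  fix v assume "v \<in> rational_in u"
  then obtain p q where *: "ev const_fn u q \<noteq> 0" "v = ev const_fn u p / ev const_fn u q"
    unfolding rational_in_def by blast
  show "- v \<in> rational_in u"
    by (rule rational_inI[of _ q _ "- p"]) (use * in auto)
  show "inverse v \<in> rational_in u"
  proof (cases "v = 0")
    case True
    thus ?thesis by (intro rational_inI[of _ 1 _ 0]) auto
  next
    case False
    thus ?thesis by (intro rational_inI[of _ p _ q]) (use * in auto)
  qed
qed

lemma rational_in_base: "const_fn k \<in> rational_in u" "u \<in> rational_in u"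
  by (rule rational_inI[of _ 1 _ "[:k:]"] rational_inI[of _ 1 _ "[:0, 1:]"]; simp)+

lemma rational_in_subset:
  assumes S: "subfield S ring_of_type_algebra" and "range const_fn \<subseteq> S" "u \<in> S"
  shows "rational_in u \<subseteq> S"
proof -
  have "ev const_fn u p \<in> S" for p
    using subfield_type_algebraD[OF S] assms by (intro const_fn.ev_closed) auto
  thus ?thesis
    using subfield_type_algebraD(8)[OF S] by (auto simp: rational_in_def)
qed

text \<open>Inverses come from the conjugate \<open>u - v * w\<close>, whose product with
  \<open>u + v * w\<close> lies in \<open>R\<close>. The case \<open>w \<in> R\<close> is
  allowed.\<close>

lemma subfield_quadratic:
  fixes R :: "'a::field set"
  assumes R: "subfield R ring_of_type_algebra" and w: "w\<^sup>2 \<in> R"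
  shows "subfield {u + v * w | u v. u \<in> R \<and> v \<in> R} ring_of_type_algebra" (is "subfield ?S _")
proof (rule subfield_type_algebraI)
  note cl = subfield_type_algebraD[OF R]
  have I: "z \<in> ?S" if "u \<in> R" "v \<in> R" "z = u + v * w" for z u v
    using that by blast
  show "1 \<in> ?S" by (rule I[of 1 0]) (auto intro: cl)
  {
    fix s t assume "s \<in> ?S" "t \<in> ?S"
    then obtain u v u' v' where *: "u \<in> R" "v \<in> R" "u' \<in> R" "v' \<in> R" "s = u + v * w" "t = u' + v' * w"
      by blast
    show "s + t \<in> ?S"
      by (rule I[of "u + u'" "v + v'"]) (use * in \<open>auto intro: cl simp: algebra_simps\<close>)
    show "s * t \<in> ?S"
      by (rule I[of "u * u' + v * v' * w\<^sup>2" "u * v' + u' * v"])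
        (use * w in \<open>auto intro!: cl simp: algebra_simps power2_eq_square\<close>)
  }
  fix s assume "s \<in> ?S"
  then obtain u v where *: "u \<in> R" "v \<in> R" "s = u + v * w" by blast
  show "- s \<in> ?S"
    by (rule I[of "- u" "- v"]) (use * in \<open>auto intro: cl\<close>)
  define n where "n = u\<^sup>2 - v\<^sup>2 * w\<^sup>2"
  have n: "n = s * (u - v * w)" by (simp add: n_def *(3) algebra_simps power2_eq_square)
  have nR: "n \<in> R" using * w by (auto intro!: cl simp: n_def)
  \<comment> \<open>If the norm \<open>n\<close> vanishes although \<open>s\<close> does not, the
    conjugate is zero, and then \<open>s = u + u\<close> lies in \<open>R\<close>.\<close>
  consider "s = 0" | "s \<noteq> 0" "n \<noteq> 0" | "s \<noteq> 0" "u = v * w" using n by auto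
  thus "inverse s \<in> ?S"
  proof cases
    case 1
    show ?thesis by (rule I[of 0 0]) (use 1 in \<open>auto intro: cl\<close>)
  next
    case 2
    have "inverse s = (u - v * w) / n" using 2 unfolding n by (simp add: field_simps)
    thus ?thesis
      by (intro I[of "u / n" "- v / n"]) (use * nR in \<open>auto intro!: cl simp: diff_divide_distrib\<close>)
  next
    case 3
    hence "s \<in> R" using cl(3)[OF *(1,1)] * by simp
    thus ?thesis by (intro I[of "inverse s" 0]) (auto intro: cl)
  qed
qed

context isogeny_data
begin

text \<open>\<open>H\<close> is \<open>p(N/D)\<close> with denominators cleared. The top power of
  \<open>N\<close> dominates since \<open>N\<close> has larger degree than \<open>D\<close>; at a
  zero of \<open>D\<close> only that term survives, and it is nonzero there.\<close>

lemma homogenisation: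
  assumes "p \<noteq> 0"
  obtains H where "fn H = fn D ^ Polynomial.degree p * ev const_fn fX p" "H \<noteq> 0"
    "Polynomial.degree H = (Polynomial.degree D + 1) * Polynomial.degree p"
    "\<And>z. ev to_ac z D = 0 \<Longrightarrow> ev to_ac z H \<noteq> 0"
proof -
  have DX: "fn D * fX = fn N" by (simp add: fX_def)
  have "\<exists>H. fn H = fn D ^ Polynomial.degree p * ev const_fn fX p \<and> H \<noteq> 0 \<and>
    Polynomial.degree H = (Polynomial.degree D + 1) * Polynomial.degree p \<and>
    (\<forall>z. ev to_ac z D = 0 \<longrightarrow> ev to_ac z H \<noteq> 0)"
    using assms
  proof (induction p)
    case (pCons k p)
    show ?case
    proof (cases "p = 0")
      case True
      thus ?thesis using pCons by (intro exI[of _ "[:k:]"]) auto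
    next
      case False
      then obtain H where H: "fn H = fn D ^ Polynomial.degree p * ev const_fn fX p" "H \<noteq> 0"
        "Polynomial.degree H = (Polynomial.degree D + 1) * Polynomial.degree p"
        "\<forall>z. ev to_ac z D = 0 \<longrightarrow> ev to_ac z H \<noteq> 0"
        using pCons.IH by blast
      let ?n = "Suc (Polynomial.degree p)"
      \<comment> \<open>One step of Horner's scheme, homogenised.\<close>
      define H' where "H' = smult k (D ^ ?n) + N * H"
      have NH: "Polynomial.degree (N * H) = (Polynomial.degree D + 1) * ?n"
        using H by (simp add: degree_mult_eq degree_N)
      have "Polynomial.degree (smult k (D ^ ?n)) \<le> Polynomial.degree D * ?n"
        using degree_smult_le[of k "D ^ ?n"] by (simp add: degree_power_eq mult.commute del: power_Suc)
      also have "\<dots> < Polynomial.degree (N * H)" unfolding NH by simp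
      finally have deg: "Polynomial.degree H' = (Polynomial.degree D + 1) * ?n"
        unfolding H'_def NH[symmetric] by (rule degree_add_eq_right)
      have "fn H' = const_fn k * fn D ^ ?n + (fn D * fX) * (fn D ^ Polynomial.degree p * ev const_fn fX p)"
        unfolding DX by (simp add: H'_def H(1))
      hence "fn H' = fn D ^ ?n * ev const_fn fX (pCons k p)"
        by (simp add: algebra_simps)
      moreover have "H' \<noteq> 0" using deg by auto
      moreover have "ev to_ac z H' \<noteq> 0" if "ev to_ac z D = 0" for z
        using that H(4) no_common_root[OF that] by (simp add: H'_def)
      ultimately show ?thesis using deg False by (intro exI[of _ H']) simp
    qed
  qed simp
  thus thesis using that by blast
qed

text \<open>
  Comparing degrees in \<open>x q(X) = p(X)\<close> gives \<open>deg p = deg q + 1\<close>, so that \<open>p(X)/q(X)\<close> has a pole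
  at each zero of \<open>D\<close>, whereas \<open>x\<close> has none.
\<close>

lemma x_not_in_rational_in_X: "x \<notin> rational_in fX"
proof
  assume "x \<in> rational_in fX"
  then obtain p q where pq: "ev const_fn fX q \<noteq> 0" "x = ev const_fn fX p / ev const_fn fX q"
    unfolding rational_in_def by blast
  have "q \<noteq> 0" "p \<noteq> 0" using pq x_nonzero by auto
  from homogenisation[OF \<open>p \<noteq> 0\<close>] obtain P where
    P: "fn P = fn D ^ Polynomial.degree p * ev const_fn fX p" "P \<noteq> 0"
    "Polynomial.degree P = (Polynomial.degree D + 1) * Polynomial.degree p"
    "\<And>z. ev to_ac z D = 0 \<Longrightarrow> ev to_ac z P \<noteq> 0" by blast
  from homogenisation[OF \<open>q \<noteq> 0\<close>] obtain Q where
    Q: "fn Q = fn D ^ Polynomial.degree q * ev const_fn fX q" "Q \<noteq> 0"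
    "Polynomial.degree Q = (Polynomial.degree D + 1) * Polynomial.degree q" by metis
  have "x * ev const_fn fX q = ev const_fn fX p" using pq by (simp add: eq_divide_eq)
  hence "x * fn Q * fn D ^ Polynomial.degree p = fn P * fn D ^ Polynomial.degree q"
    by (simp add: P(1) Q(1) algebra_simps)
  hence "fn ([:0, 1:] * Q * D ^ Polynomial.degree p) = fn (P * D ^ Polynomial.degree q)"
    by (simp add: mult.assoc)
  hence eq: "[:0, 1:] * Q * D ^ Polynomial.degree p = P * D ^ Polynomial.degree q"
    by (simp only: ev_const_fn_x_fn_inject)
  have deg1: "Polynomial.degree ([:0, 1:] * Q * D ^ Polynomial.degree p) =
      1 + (Polynomial.degree D + 1) * Polynomial.degree q + Polynomial.degree D * Polynomial.degree p"
    using Q by (simp add: degree_mult_eq degree_power_eq)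
  have deg2: "Polynomial.degree (P * D ^ Polynomial.degree q) =
      (Polynomial.degree D + 1) * Polynomial.degree p + Polynomial.degree D * Polynomial.degree q"
    using P by (simp add: degree_mult_eq degree_power_eq)
  have "Polynomial.degree p = Suc (Polynomial.degree q)"
    using trans[OF sym[OF deg1[unfolded eq]] deg2] by (simp add: algebra_simps)
  hence "[:0, 1:] * Q * D * D ^ Polynomial.degree q = P * D ^ Polynomial.degree q"
    using eq by (simp add: mult.assoc)
  hence eq': "[:0, 1:] * Q * D = P"
    by (simp only: mult_right_cancel[OF power_not_zero[OF polys_nonzero(1)]])
  have "Polynomial.degree (map_poly to_ac D) > 0"
    using degree_D by (simp add: degree_map_poly)
  then obtain z where "poly (map_poly to_ac D) z = 0"
    using alg_closed_imp_poly_has_root by blast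
  hence z: "ev to_ac z D = 0" by (simp add: ev_def)
  have "ev to_ac z ([:0, 1:] * Q * D) = 0" by (simp add: z)
  thus False using P(4)[OF z] unfolding eq' by simp
qed

definition pullback_field where
  "pullback_field = generate_field ring_of_type_algebra (range const_fn \<union> set_point \<phi>)"

lemma pullback_subset:
  assumes S: "subfield S ring_of_type_algebra" and "range const_fn \<subseteq> S" "fX \<in> S" "fY \<in> S"
  shows "pullback_field \<subseteq> S"
  unfolding pullback_field_def \<phi>_def target_point_def
  by (rule generate_field_subset[OF S]) (use assms in \<open>auto intro!: subfield_type_algebraD[OF S]\<close>)

lemma subfield_pullback_field: "subfield pullback_field ring_of_type_algebra"
  unfolding pullback_field_def by (rule subfield_generate_field)

text \<open>The generators are the coordinates in the general Weierstrass form; undoing the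
  substitution recovers \<open>fX\<close> and \<open>fY\<close>.\<close>

lemma pullback_base: "const_fn k \<in> pullback_field" "fX \<in> pullback_field" "fY \<in> pullback_field"
proof -
  note cl = subfield_type_algebraD[OF subfield_pullback_field]
  show k: "const_fn k \<in> pullback_field" for k
    unfolding pullback_field_def by (rule generate_field.incl) auto
  have Xe: "fX + const_fn e \<in> pullback_field"
    and Ye: "fY - const_fn h1 * (fX + const_fn e) - const_fn h3 \<in> pullback_field"
    unfolding pullback_field_def by (rule generate_field.incl; simp add: \<phi>_def target_point_def)+
  show "fX \<in> pullback_field" using cl(7)[OF Xe k[of e]] by simp
  show "fY \<in> pullback_field"
    using cl(3)[OF cl(3)[OF Ye k[of h3]] cl(4)[OF k[of h1] Xe]] by simp
qed

text \<open>The pullback field lies in \<open>K(X) + K(X) Y\<close>. If \<open>x = u + v Y\<close>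
  there, then \<open>v \<noteq> 0\<close> because \<open>x\<close> is not in \<open>K(X)\<close>; so
  \<open>Y\<close>, and with it \<open>y\<close>, would be a rational function of
  \<open>x\<close>.\<close>

lemma x_not_in_pullback_field: "x \<notin> pullback_field"
proof
  assume "x \<in> pullback_field"
  let ?R = "rational_in fX"
  note clR = subfield_type_algebraD[OF subfield_rational_in[of fX]]
  note cl = subfield_type_algebraD[OF subfield_rational_in[of x]]
  let ?S = "{u + v * fY | u v. u \<in> ?R \<and> v \<in> ?R}"
  have "fY\<^sup>2 \<in> ?R"
    unfolding XY_equation by (intro clR rational_in_base)
  hence S: "subfield ?S ring_of_type_algebra"
    by (rule subfield_quadratic[OF subfield_rational_in])
  have R_S: "u \<in> ?S" if "u \<in> ?R" for u
    using that clR(1) by (intro CollectI exI[of _ u] exI[of _ 0]) auto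
  have "fY \<in> ?S"
    using clR(1,2) by (intro CollectI exI[of _ 0] exI[of _ 1]) auto
  moreover have "fX \<in> ?S" "range const_fn \<subseteq> ?S"
    using R_S rational_in_base by blast+
  ultimately have "pullback_field \<subseteq> ?S"
    by (intro pullback_subset[OF S])
  then obtain u v where uv: "x = u + v * fY" "u \<in> ?R" "v \<in> ?R"
    using \<open>x \<in> pullback_field\<close> by blast
  have "v \<noteq> 0" using uv x_not_in_rational_in_X by auto
  have fn: "fn p \<in> rational_in x" for p
    by (rule rational_inI[of _ 1 _ p]) auto
  have "fX \<in> rational_in x" unfolding fX_def by (intro cl fn)
  hence sub: "?R \<subseteq> rational_in x"
    by (intro rational_in_subset subfield_rational_in) (auto intro: rational_in_base)
  have "fY = (x - u) / v" using uv(1) \<open>v \<noteq> 0\<close> by (simp add: field_simps)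
  moreover have "y = fY * (fn D)\<^sup>2 / fn M"
    by (simp add: fY_def)
  ultimately have "y = (x - u) / v * (fn D)\<^sup>2 / fn M"
    by simp
  moreover have "(x - u) / v * (fn D)\<^sup>2 / fn M \<in> rational_in x"
    using uv sub by (intro cl fn) (auto intro: rational_in_base)
  ultimately obtain p q where "fn q \<noteq> 0" "y = fn p / fn q"
    unfolding rational_in_def by auto
  hence "y * fn q = fn p" "q \<noteq> 0" by auto
  thus False using y_not_rational by blast
qed

lemma finite_over_pullback_field:
  "ring.finite_dimension ring_of_type_algebra pullback_field (function_field source)"
proof (rule finite_dimension_if_simple[OF subfield_pullback_field subfield_function_field])
  show "pullback_field \<subseteq> function_field source"
    using XY_in_function_field function_field_base
    by (intro pullback_subset[OF subfield_function_field]) auto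
  \<comment> \<open>\<open>x\<close> is a root of \<open>N(T) - X D(T)\<close>. This is nonzero
    because \<open>N\<close> has the larger degree, so its leading coefficient is not
    disturbed.\<close>
  define q where "q = map_poly const_fn N - smult fX (map_poly const_fn D)"
  have inj: "const_fn k = 0 \<longleftrightarrow> k = 0" for k :: 'k
    using ev_const_fn_x_fn_eq_0_iff[of "[:k:]"] by simp
  have "Polynomial.coeff q (Polynomial.degree N) = const_fn (Polynomial.lead_coeff N)"
    using degree_N by (simp add: q_def coeff_map_poly coeff_eq_0)
  thus "q \<noteq> 0" using inj polys_nonzero(2) by auto
  have "Polynomial.coeff q i \<in> pullback_field" for i
    using pullback_base subfield_type_algebraD[OF subfield_pullback_field]
    by (simp add: q_def coeff_map_poly)
  thus "set (coeffs q) \<subseteq> pullback_field" by (auto simp: coeffs_def)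
  show "poly q x = 0"
    using fn_nonzero by (simp add: q_def fX_def flip: ev_def)
  fix S :: "'k ambient set"
  assume S: "subfield S ring_of_type_algebra" "pullback_field \<subseteq> S" "x \<in> S"
  note cl = subfield_type_algebraD[OF S(1)]
  have fn: "fn p \<in> S" for p
    using cl S pullback_base by (intro const_fn.ev_closed) auto
  \<comment> \<open>Adjoining \<open>x\<close> alone suffices, since \<open>y\<close> is recovered
    from \<open>fY\<close> and \<open>x\<close>.\<close>
  have "y = fY * (fn D)\<^sup>2 / fn M" by (simp add: fY_def)
  moreover have "fY * (fn D)\<^sup>2 / fn M \<in> S"
    using pullback_base S fn by (intro cl) auto
  ultimately show "function_field source \<subseteq> S"
    unfolding function_field_def using S pullback_base
    by (intro generate_field_subset[OF S(1)]) (auto simp flip: y_def)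
qed

theorem isogeny_degree_gt_1: "isogeny_degree source \<phi> > 1"
proof -
  have "pullback_field \<subset> function_field source"
    using XY_in_function_field function_field_base x_not_in_pullback_field
    by (intro psubsetI pullback_subset[OF subfield_function_field]) auto
  thus ?thesis
    unfolding isogeny_degree_def pullback_field_def[symmetric]
    by (intro extension_degree_gt_1 subfield_pullback_field subfield_function_field
        finite_over_pullback_field)
qed

theorem K_magnifiedI:
  assumes "elliptic_curve source" and w: "w\<^sup>2 = poly f z" and D: "poly D z \<noteq> 0"
    and P: "P = target_point (\<lambda>k. k) (poly N z / poly D z) (w * poly M z / (poly D z)\<^sup>2)"
  shows "K_magnified target P"
  unfolding K_magnified_def
proof (intro exI conjI)
  show "elliptic_curve source" by fact
  show "isogeny source target \<phi>" by (rule isogeny)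
  show "isogeny_degree source \<phi> > 1" by (rule isogeny_degree_gt_1)
  have hom: "comm_hom (\<lambda>k::'k. k)" by unfold_locales auto
  show "on_curve source (Affine z w)"
    using on_curve_short[OF hom, of a b c z w] w
    by (simp add: source_def f_def poly_eq_ev curve.map_ident)
  show "maps_to source \<phi> (map_point to_ac (Affine z w)) (map_point to_ac P)"
    using maps_to_affine[of "to_ac z" "to_ac w"] D by (simp add: ev_to_ac P target_point_def)
qed

end

section \<open>Doubling and isogenies of degree two\<close>

text \<open>The discriminant of the monic cubic
  \<open>X ^ 3 + a X\<^sup>2 + b X + c\<close>.\<close>

abbreviation cubic_disc :: "'a::comm_ring_1 \<Rightarrow> 'a \<Rightarrow> 'a \<Rightarrow> 'a" where
  "cubic_disc a b c \<equiv> a\<^sup>2 * b\<^sup>2 - 4 * b ^ 3 - 4 * a ^ 3 * c - 27 * c\<^sup>2 + 18 * a * b * c"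

text \<open>The arguments on the left are the coefficients of the cubic after replacing
  \<open>X\<close> by \<open>X + e\<close>, which preserves differences of roots.\<close>

lemma cubic_disc_shift:
  fixes a b c e :: "'a::comm_ring_1"
  shows "cubic_disc (a + 3 * e) (b + 2 * e * a + 3 * e\<^sup>2) (c + e * b + e\<^sup>2 * a + e ^ 3) = cubic_disc a b c"
  by (simp add: algebra_simps power2_eq_square power3_eq_cube)

text \<open>The arguments on the right are the coefficients of the cubic obtained by completing the
  square.\<close>

lemma discriminant_eq:
  "discriminant (Weierstrass (2 * h1) a2 (2 * h3) a4 a6) =
     16 * cubic_disc (a2 + h1\<^sup>2) (a4 + 2 * h1 * h3) (a6 + h3\<^sup>2)"
  unfolding discriminant.simps Let_def by Groebner_Basis.algebra

lemma cubic_disc_eq_0_if_double_root: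
  fixes z :: "'a::field"
  assumes "z ^ 3 + a * z\<^sup>2 + b * z + c = 0" "3 * z\<^sup>2 + 2 * a * z + b = 0"
  shows "cubic_disc a b c = 0"
  using assms by Groebner_Basis.algebra

text \<open>Source and target share the same short form, and the isogeny is multiplication by 2. The
  conclusion writes the double of \<open>(z, w)\<close> by means of the tangent slope
  \<open>m\<close>.\<close>

lemma K_magnified_by_doubling:
  fixes h1 a2 h3 a4 a6 e :: "'k::field"
  defines "a \<equiv> a2 + h1\<^sup>2 + 3 * e" and "b \<equiv> a4 + 2 * h1 * h3 + 2 * e * (a2 + h1\<^sup>2) + 3 * e\<^sup>2"
    and "c \<equiv> a6 + h3\<^sup>2 + e * (a4 + 2 * h1 * h3) + e\<^sup>2 * (a2 + h1\<^sup>2) + e ^ 3"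
  assumes two: "(2::'k) \<noteq> 0" and disc: "cubic_disc a b c \<noteq> 0"
    and w: "w\<^sup>2 = z ^ 3 + a * z\<^sup>2 + b * z + c" "w \<noteq> 0"
    and slope: "2 * w * m = 3 * z\<^sup>2 + 2 * a * z + b"
  shows "K_magnified (Weierstrass (2 * h1) a2 (2 * h3) a4 a6)
    (let u = m\<^sup>2 - a - 2 * z; v = - (w + m * (u - z)) in Affine (u + e) (v - h1 * (u + e) - h3))"
proof -
  define f where "f = [:c, b, a, 1:]"
  \<comment> \<open>The duplication formula: \<open>N / D\<close> is the abscissa of the double,
    with \<open>D = 4 f\<close>, and \<open>y M / D\<^sup>2\<close> its ordinate. \<open>M\<close>
    is the quotient of the fourth division polynomial by the second.\<close>
  define N D G M where "N = [:b\<^sup>2 - 4 * a * c, - 8 * c, - 2 * b, 0, 1:]"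
    and "D = smult 4 f" and "G = [:1 / 4 :: 'k:]"
    and "M = [:2 * (4 * a * b * c - b ^ 3 - 8 * c\<^sup>2), 2 * (8 * a\<^sup>2 * c - 2 * a * b\<^sup>2 - 4 * b * c),
      2 * (20 * a * c - 5 * b\<^sup>2), 40 * c, 10 * b, 4 * a, 2:]"
  have four: "(4::'k) \<noteq> 0"
    using two mult_eq_0_iff[of 2 "2::'k"] by simp
  have evf: "poly f t = t ^ 3 + a * t\<^sup>2 + b * t + c" for t
    by (simp add: f_def algebra_simps power2_eq_square power3_eq_cube)
  interpret I: isogeny_data a b c h1 a2 h3 a4 a6 e a b c N D M G
  proof
    show "[:c, b, a, 1:] = D * G"
      using four by (simp add: f_def D_def G_def)
    have "4 * G = 1" using four by (simp add: G_def one_pCons numeral_poly)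
    moreover have "M\<^sup>2 = 4 * (N ^ 3 + [:a:] * N\<^sup>2 * D + [:b:] * N * D\<^sup>2 + [:c:] * D ^ 3)"
    proof -
      \<comment> \<open>In terms of \<open>T\<close> and constant polynomials the claim is an
        identity in a commutative ring.\<close>
      define T where "T = [:0, 1::'k:]"
      note poly_simps = T_def numeral_poly one_pCons algebra_simps eval_nat_numeral
      have N: "N = T ^ 4 - 2 * [:b:] * T\<^sup>2 - 8 * [:c:] * T + [:b:]\<^sup>2 - 4 * [:a:] * [:c:]"
        by (simp add: N_def poly_simps)
      have D: "D = 4 * (T ^ 3 + [:a:] * T\<^sup>2 + [:b:] * T + [:c:])"
        by (simp add: D_def f_def poly_simps)
      have M: "M = 2 * (T ^ 6 + 2 * [:a:] * T ^ 5 + 5 * [:b:] * T ^ 4 + 20 * [:c:] * T ^ 3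
          + (20 * [:a:] * [:c:] - 5 * [:b:]\<^sup>2) * T\<^sup>2
          + (8 * [:a:]\<^sup>2 * [:c:] - 2 * [:a:] * [:b:]\<^sup>2 - 4 * [:b:] * [:c:]) * T
          + (4 * [:a:] * [:b:] * [:c:] - [:b:] ^ 3 - 8 * [:c:]\<^sup>2))"
        by (simp add: M_def poly_simps)
      show ?thesis
        unfolding N D M by Groebner_Basis.algebra
    qed
    ultimately show "M\<^sup>2 * G = N ^ 3 + [:a:] * N\<^sup>2 * D + [:b:] * N * D\<^sup>2 + [:c:] * D ^ 3"
      by Groebner_Basis.algebra
    show "Polynomial.degree D > 0" "Polynomial.degree N = Polynomial.degree D + 1"
      "Polynomial.degree M = 2 * Polynomial.degree D"
      using two four by (simp_all add: D_def f_def N_def M_def)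
    fix z assume "ev to_ac z D = 0"
    hence "ev to_ac z f = 0"
      using four to_ac_eq_0_iff[of "4::'k"] by (simp add: D_def)
    hence fz: "z ^ 3 + to_ac a * z\<^sup>2 + to_ac b * z + to_ac c = 0"
      by (simp add: f_def algebra_simps power2_eq_square power3_eq_cube)
    \<comment> \<open>Modulo \<open>f\<close>, the polynomial \<open>N\<close> is the square of the
      derivative of \<open>f\<close>. A common zero would therefore be a double root of
      \<open>f\<close>.\<close>
    show "ev to_ac z N \<noteq> 0"
    proof
      assume "ev to_ac z N = 0"
      hence "z ^ 4 - 2 * to_ac b * z\<^sup>2 - 8 * to_ac c * z + (to_ac b)\<^sup>2 - 4 * to_ac a * to_ac c = 0"
        by (simp add: N_def algebra_simps eval_nat_numeral)
      hence "(3 * z\<^sup>2 + 2 * to_ac a * z + to_ac b)\<^sup>2 = 0"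
        using fz by Groebner_Basis.algebra
      hence "cubic_disc (to_ac a) (to_ac b) (to_ac c) = 0"
        by (intro cubic_disc_eq_0_if_double_root[OF fz]) simp
      also have "cubic_disc (to_ac a) (to_ac b) (to_ac c) = to_ac (cubic_disc a b c)"
        by simp
      finally show False using disc by (simp only: to_ac_eq_0_iff)
    qed
  qed (simp_all add: a_def b_def c_def)
  have Dz: "poly D z = 4 * w\<^sup>2" by (simp add: D_def evf w(1))
  hence D0: "poly D z \<noteq> 0" using w(2) four by simp
  have mag: "K_magnified I.target (I.target_point (\<lambda>k. k) (poly N z / poly D z) (w * poly M z / (poly D z)\<^sup>2))"
  proof (rule I.K_magnifiedI)
    have "discriminant I.source = 4\<^sup>2 * cubic_disc a b c"
      unfolding I.source_def discriminant.simps Let_def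
      by (simp add: algebra_simps eval_nat_numeral)
    moreover have "(4::'k)\<^sup>2 \<noteq> 0" using four by (rule power_not_zero)
    ultimately show "elliptic_curve I.source"
      using disc unfolding elliptic_curve_def by (simp only: mult_eq_0_iff simp_thms)
    show "w\<^sup>2 = poly I.f z" using w by (simp add: I.f_def evf flip: f_def)
    show "poly D z \<noteq> 0" by (rule D0)
  qed simp
  \<comment> \<open>The slope and curve equations eliminate \<open>b\<close> and \<open>c\<close>,
    and the duplication formula becomes the tangent formula identically.\<close>
  have b: "b = 2 * w * m - 3 * z\<^sup>2 - 2 * a * z" using slope by simp
  have c: "c = w\<^sup>2 - z ^ 3 - a * z\<^sup>2 - b * z" using w by simp
  have "poly N z = (m\<^sup>2 - a - 2 * z) * poly D z"
    unfolding Dz N_def poly_pCons poly_0 c b by Groebner_Basis.algebra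
  hence X: "poly N z / poly D z = m\<^sup>2 - a - 2 * z"
    by (simp only: nonzero_mult_div_cancel_right[OF D0])
  have "w * poly M z = - (w + m * (m\<^sup>2 - a - 2 * z - z)) * (poly D z)\<^sup>2"
    unfolding Dz M_def poly_pCons poly_0 c b by Groebner_Basis.algebra
  hence Y: "w * poly M z / (poly D z)\<^sup>2 = - (w + m * (m\<^sup>2 - a - 2 * z - z))"
    by (simp only: nonzero_mult_div_cancel_right[OF power_not_zero[OF D0]])
  show ?thesis
    using mag unfolding X Y I.target_def I.target_point_def Let_def .
qed

text \<open>By \<open>c\<close>, the abscissa \<open>e\<close> belongs to a 2-torsion point, which
  the short form puts at the origin. The isogeny comes from
  \<open>Y\<^sup>2 = X (X\<^sup>2 - 2 a X + d)\<close> and has first coordinate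
  \<open>(y / (2 x))\<^sup>2\<close>, so a point whose abscissa is the square
  \<open>\<rho>\<^sup>2\<close> can be lifted.\<close>

lemma K_magnified_by_two_isogeny:
  fixes h1 a2 h3 a4 a6 e :: "'k::field"
  defines "a \<equiv> a2 + h1\<^sup>2 + 3 * e" and "b \<equiv> a4 + 2 * h1 * h3 + 2 * e * (a2 + h1\<^sup>2) + 3 * e\<^sup>2"
  assumes two: "(2::'k) \<noteq> 0" and disc: "b \<noteq> 0" "a\<^sup>2 - 4 * b \<noteq> 0"
    and c: "a6 + h3\<^sup>2 + e * (a4 + 2 * h1 * h3) + e\<^sup>2 * (a2 + h1\<^sup>2) + e ^ 3 = 0"
    and v: "v\<^sup>2 = (\<rho>\<^sup>2) ^ 3 + a * (\<rho>\<^sup>2)\<^sup>2 + b * \<rho>\<^sup>2" and \<rho>: "\<rho> \<noteq> 0"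
  shows "K_magnified (Weierstrass (2 * h1) a2 (2 * h3) a4 a6)
    (Affine (\<rho>\<^sup>2 + e) (v - h1 * (\<rho>\<^sup>2 + e) - h3))"
proof -
  define d where "d = a\<^sup>2 - 4 * b"
  define N D G M where "N = [:d, - 2 * a, 1:]"
    and "D = [:0, 4 :: 'k:]" and "G = smult (1 / 4) N" and "M = [:2 * d, 0, - 2:]"
  have four: "(4::'k) \<noteq> 0"
    using two mult_eq_0_iff[of 2 "2::'k"] by simp
  interpret I: isogeny_data "- 2 * a" d 0 h1 a2 h3 a4 a6 e a b 0 N D M G
  proof
    show "[:0, d, - 2 * a, 1:] = D * G"
      using four by (simp add: N_def D_def G_def)
    have G4: "4 * G = N" using four by (simp add: G_def one_pCons numeral_poly)
    have M2: "M\<^sup>2 = 4 * (N\<^sup>2 + [:a:] * N * D + [:b:] * D\<^sup>2)"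
      by (simp add: M_def N_def D_def d_def numeral_poly one_pCons algebra_simps eval_nat_numeral)
    have "M\<^sup>2 * G = (4 * G) * (N\<^sup>2 + [:a:] * N * D + [:b:] * D\<^sup>2)"
      unfolding M2 by (simp only: ac_simps)
    also have "\<dots> = N ^ 3 + [:a:] * N\<^sup>2 * D + [:b:] * N * D\<^sup>2"
      unfolding G4 by Groebner_Basis.algebra
    finally show "M\<^sup>2 * G = N ^ 3 + [:a:] * N\<^sup>2 * D + [:b:] * N * D\<^sup>2 + [:0:] * D ^ 3"
      by simp
    show "Polynomial.degree D > 0" "Polynomial.degree N = Polynomial.degree D + 1"
      "Polynomial.degree M = 2 * Polynomial.degree D"
      using two four by (simp_all add: D_def N_def M_def)
    fix z assume "ev to_ac z D = 0"
    hence "z = 0" using four to_ac_eq_0_iff[of "4::'k"] by (simp add: D_def)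
    thus "ev to_ac z N \<noteq> 0" using disc by (simp add: N_def d_def del: to_ac_diff)
  qed (simp_all add: a_def b_def c)
  \<comment> \<open>The preimage is found by solving \<open>y = 2 \<rho> x\<close> and \<open>\<rho> (d - x\<^sup>2) = 4 x v\<close>.\<close>
  define z where "z = 2 * \<rho>\<^sup>2 + a - 2 * v / \<rho>"
  have z\<rho>: "z * \<rho> = 2 * \<rho> ^ 3 + a * \<rho> - 2 * v"
    using \<rho> by (simp add: z_def field_simps eval_nat_numeral)
  have quad: "z\<^sup>2 - (2 * a + 4 * \<rho>\<^sup>2) * z + d = 0"
  proof -
    \<comment> \<open>Squaring \<open>2 v = \<rho> (2 \<rho>\<^sup>2 + a - z)\<close> and inserting
      the curve equation for \<open>v\<^sup>2\<close> gives this.\<close>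
    have "(z\<^sup>2 - (2 * a + 4 * \<rho>\<^sup>2) * z + d) * \<rho>\<^sup>2 = 0"
      using z\<rho> v unfolding d_def by Groebner_Basis.algebra
    thus ?thesis using \<rho> by simp
  qed
  have z: "z \<noteq> 0" using quad disc by (auto simp: d_def)
  have v4: "4 * z * v = \<rho> * (d - z\<^sup>2)"
    using quad z\<rho> by Groebner_Basis.algebra
  have "K_magnified I.target
    (I.target_point (\<lambda>k. k) (poly N z / poly D z) (2 * \<rho> * z * poly M z / (poly D z)\<^sup>2))"
  proof (rule I.K_magnifiedI)
    have "discriminant I.source = 4 ^ 4 * d\<^sup>2 * b"
      unfolding I.source_def discriminant.simps Let_def unfolding d_def
      by (simp add: algebra_simps eval_nat_numeral)
    moreover have "(4::'k) ^ 4 \<noteq> 0" using four by (rule power_not_zero)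
    ultimately show "elliptic_curve I.source"
      using disc unfolding elliptic_curve_def by (simp add: d_def)
    show "(2 * \<rho> * z)\<^sup>2 = poly I.f z"
      using quad unfolding I.f_def by simp Groebner_Basis.algebra
    show "poly D z \<noteq> 0" using z four by (simp add: D_def)
  qed simp
  moreover have "poly N z = \<rho>\<^sup>2 * poly D z"
    using quad by (simp add: N_def D_def) Groebner_Basis.algebra
  moreover have "2 * \<rho> * z * poly M z = v * (poly D z)\<^sup>2"
    using v4 by (simp add: M_def D_def) Groebner_Basis.algebra
  moreover have "poly D z \<noteq> 0" using z four by (simp add: D_def)
  ultimately show ?thesis
    by (simp add: I.target_def I.target_point_def)
qed

section \<open>Halving a point\<close>

text \<open>A nonzero polynomial of least degree vanishing at \<open>m\<close> divides
  \<open>g\<close>, since the remainder also vanishes at \<open>m\<close>. Its degree is 1, 2 or 3,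
  and degree 3 leaves a linear cofactor.\<close>

lemma reducible_quartic:
  fixes g p :: "'k::field poly"
  assumes g: "Polynomial.degree g = 4" "ev to_ac m g = 0"
    and p: "p \<noteq> 0" "Polynomial.degree p < 4" "ev to_ac m p = 0"
  shows "(\<exists>k. poly g k = 0) \<or> (\<exists>q r. Polynomial.degree q = 2 \<and> Polynomial.degree r = 2 \<and> g = q * r)"
proof -
  obtain p where p: "p \<noteq> 0" "Polynomial.degree p < 4" "ev to_ac m p = 0"
    and min: "\<And>q. q \<noteq> 0 \<Longrightarrow> ev to_ac m q = 0 \<Longrightarrow> Polynomial.degree p \<le> Polynomial.degree q"
    using ex_has_least_nat[of "\<lambda>p. p \<noteq> 0 \<and> ev to_ac m p = 0" p Polynomial.degree] p
    by (metis le_less_trans)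
  have "ev to_ac m (g mod p) = 0"
    using g(2) p(3) by (simp flip: minus_div_mult_eq_mod)
  hence "g mod p = 0"
    using min[of "g mod p"] degree_mod_less[OF p(1), of g] by fastforce
  then obtain r where r: "g = p * r" by auto
  have root: "\<exists>k. poly q k = 0" if q: "Polynomial.degree q = 1" for q :: "'k poly"
  proof -
    obtain u v where "q = [:u, v:]" "v \<noteq> 0"
      using degree1_coeffs[OF q] by metis
    thus ?thesis by (intro exI[of _ "- u / v"]) simp
  qed
  have "Polynomial.degree p \<noteq> 0"
  proof
    assume "Polynomial.degree p = 0"
    then obtain u where "p = [:u:]" by (metis degree_eq_zeroE)
    thus False using p by simp
  qed
  moreover have "Polynomial.degree p + Polynomial.degree r = 4"
    using g(1) r degree_mult_eq[of p r] by fastforce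
  ultimately consider "Polynomial.degree p = 1" | "Polynomial.degree p = 2" "Polynomial.degree r = 2"
    | "Polynomial.degree r = 1"
    using p(2) by linarith
  thus ?thesis
  proof cases
    case 1
    thus ?thesis using root[of p] r by auto
  next
    case 2
    thus ?thesis using r by blast
  next
    case 3
    thus ?thesis using root[of r] r by auto
  qed
qed

text \<open>The leading coefficients have product 1, so each factor becomes monic when multiplied by
  the leading coefficient of the other. The missing cubic term makes the linear coefficients
  \<open>p\<close> and \<open>- p\<close>.\<close>

lemma monic_quadratic_factors:
  fixes q r :: "'k::field poly"
  assumes "Polynomial.degree q = 2" "Polynomial.degree r = 2" "[:g0, g1, g2, 0, 1:] = q * r"
  obtains s t p where "t + s - p\<^sup>2 = g2" "p * (t - s) = g1" "s * t = g0"
proof -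
  obtain q0 q1 q2 where q: "q = [:q0, q1, q2:]" "q2 \<noteq> 0"
    using degree2_coeffs[OF assms(1)] by metis
  obtain r0 r1 r2 where r: "r = [:r0, r1, r2:]" "r2 \<noteq> 0"
    using degree2_coeffs[OF assms(2)] by metis
  have eqs: "q0 * r0 = g0" "q0 * r1 + q1 * r0 = g1" "q0 * r2 + q1 * r1 + q2 * r0 = g2"
    "q1 * r2 + q2 * r1 = 0" "q2 * r2 = 1"
    using assms(3) by (auto simp: q r algebra_simps)
  have "r1 = r2 * (q1 * r2 + q2 * r1) - q1 * r2\<^sup>2"
    using eqs(5) by (simp add: algebra_simps power2_eq_square)
  hence r1: "r1 = - (q1 * r2\<^sup>2)" by (simp add: eqs(4))
  show thesis
  proof (rule that)
    show "(q2 * r0) + (r2 * q0) - (r2 * q1)\<^sup>2 = g2"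
      unfolding eqs(3)[symmetric] r1 by Groebner_Basis.algebra
    show "(r2 * q1) * (q2 * r0 - r2 * q0) = g1"
      using eqs(5) unfolding eqs(2)[symmetric] r1 by Groebner_Basis.algebra
    have "(r2 * q0) * (q2 * r0) = (q2 * r2) * (q0 * r0)" by (simp only: ac_simps)
    thus "(r2 * q0) * (q2 * r0) = g0" by (simp add: eqs)
  qed
qed

text \<open>
  Here the point to be halved is \<open>(0, v)\<close> on \<open>Y\<^sup>2 = X\<^sup>3 + a X\<^sup>2 + b X + v\<^sup>2\<close>, and \<open>m\<close> is the slope of
  the tangent at a half \<open>(z, w)\<close>, which passes through \<open>(0, -v)\<close>.
\<close>

lemma tangent_slope_quartic:
  fixes a b :: "'a::comm_ring_1"
  assumes "2 * w * m = 3 * z\<^sup>2 + 2 * a * z + b" "m\<^sup>2 - a - 2 * z = 0" "w = m * z - v"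
  shows "m ^ 4 - 2 * a * m\<^sup>2 - 8 * v * m + a\<^sup>2 - 4 * b = 0"
proof -
  have a: "a = m\<^sup>2 - 2 * z" using assms(2) by (simp add: algebra_simps)
  have b: "b = 2 * w * m - 3 * z\<^sup>2 - 2 * a * z" using assms(1) by simp
  show ?thesis
    unfolding b assms(3) a by (simp add: algebra_simps eval_nat_numeral)
qed

text \<open>The converse: \<open>z\<close> is solved from the abscissa formula and \<open>w\<close>
  from the tangent line, after which the quartic says \<open>b = z\<^sup>2 - 2 v m\<close>. If
  \<open>w\<close> were 0, \<open>z\<close> would be a double root of the cubic.\<close>

lemma half_of_slope:
  fixes a b :: "'a::field"
  assumes two: "(2::'a) \<noteq> 0" and disc: "cubic_disc a b (v\<^sup>2) \<noteq> 0"
    and g: "m ^ 4 - 2 * a * m\<^sup>2 - 8 * v * m + a\<^sup>2 - 4 * b = 0"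
  defines "z \<equiv> (m\<^sup>2 - a) / 2"
  defines "w \<equiv> m * z - v"
  shows "w\<^sup>2 = z ^ 3 + a * z\<^sup>2 + b * z + v\<^sup>2" "2 * w * m = 3 * z\<^sup>2 + 2 * a * z + b" "w \<noteq> 0"
proof -
  have a: "a = m\<^sup>2 - 2 * z" using two by (simp add: z_def field_simps)
  have four: "(4::'a) \<noteq> 0"
    using two mult_eq_0_iff[of 2 "2::'a"] by simp
  have "4 * b = 4 * (z\<^sup>2 - 2 * v * m)"
    using g unfolding a by (simp add: algebra_simps eval_nat_numeral)
  hence b: "b = z\<^sup>2 - 2 * v * m" by (simp only: mult_left_cancel[OF four])
  show c: "w\<^sup>2 = z ^ 3 + a * z\<^sup>2 + b * z + v\<^sup>2"
    unfolding w_def b a by Groebner_Basis.algebra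
  show slope: "2 * w * m = 3 * z\<^sup>2 + 2 * a * z + b"
    unfolding w_def b a by Groebner_Basis.algebra
  show "w \<noteq> 0"
  proof
    assume "w = 0"
    hence "cubic_disc a b (v\<^sup>2) = 0"
      using c slope by (intro cubic_disc_eq_0_if_double_root[of z]) simp_all
    thus False using disc by simp
  qed
qed

lemma two_neq_zero_if_CHAR:
  assumes "CHAR('a::field) \<noteq> 2"
  shows "(2::'a) \<noteq> 0"
proof
  assume "(2::'a) = 0"
  hence "CHAR('a) dvd 2" by (metis of_nat_eq_0_iff_char_dvd of_nat_numeral)
  hence "CHAR('a) = 1 \<or> CHAR('a) = 2"
    using two_is_prime_nat prime_nat_iff by blast
  thus False using assms CHAR_not_1 by (simp add: CHAR_not_1')
qed

theorem theorem1p2: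
  fixes E :: "'k::field curve" and P :: "'k point"
  assumes "CHAR('k) \<noteq> 2"
    and "elliptic_curve E"
    and "on_curve E P"
    and "\<not> torsion_point E P"
    and "magnified_by_doubling E P"
  shows "K_magnified E P"
proof -
  have two: "(2::'k) \<noteq> 0" by (rule two_neq_zero_if_CHAR[OF assms(1)])
  obtain a1 a2 a3 a4 a6 where "E = Weierstrass a1 a2 a3 a4 a6" by (cases E)
  moreover define h1 h3 where "h1 = a1 / 2" and "h3 = a3 / 2"
  moreover have "2 * h1 = a1" "2 * h3 = a3" using two by (simp_all add: h1_def h3_def)
  ultimately have E: "E = Weierstrass (2 * h1) a2 (2 * h3) a4 a6" by simp
  obtain x0 y0 where P: "P = Affine x0 y0"
  proof (cases P)
    case Infinity
    have "point_mult E 1 P = Infinity" by (simp add: point_mult_def Infinity)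
    thus ?thesis using assms(4) by (auto simp: torsion_point_def)
  qed
  \<comment> \<open>Completing the square and shifting by \<open>x0\<close> moves \<open>P\<close>
    to \<open>(0, v)\<close> on the short curve with coefficients \<open>a\<close>, \<open>b\<close>
    and \<open>v\<^sup>2\<close>.\<close>
  define v where "v = y0 + h1 * x0 + h3"
  define a where "a = a2 + h1\<^sup>2 + 3 * x0"
  define b where "b = a4 + 2 * h1 * h3 + 2 * x0 * (a2 + h1\<^sup>2) + 3 * x0\<^sup>2"
  have c: "a6 + h3\<^sup>2 + x0 * (a4 + 2 * h1 * h3) + x0\<^sup>2 * (a2 + h1\<^sup>2) + x0 ^ 3 = v\<^sup>2"
    using assms(3) by (simp add: E P v_def algebra_simps power2_eq_square power3_eq_cube)
  \<comment> \<open>\<open>v = 0\<close> means that \<open>P\<close> is its own negative, hence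
    torsion.\<close>
  have v0: "v \<noteq> 0"
  proof
    assume "v = 0"
    hence "y0 + y0 + 2 * h1 * x0 + 2 * h3 = 0"
      unfolding v_def by Groebner_Basis.algebra
    hence "point_mult E 2 P = Infinity"
      by (simp add: point_mult_def E P eval_nat_numeral)
    moreover have "(2::nat) > 0" by simp
    ultimately show False using assms(4) unfolding torsion_point_def by blast
  qed
  have disc0: "cubic_disc (a2 + h1\<^sup>2) (a4 + 2 * h1 * h3) (a6 + h3\<^sup>2) \<noteq> 0"
    using assms(2) unfolding elliptic_curve_def E discriminant_eq by (rule contrapos_nn) (simp only: mult_zero_right)
  have eq: "cubic_disc a b (v\<^sup>2) = cubic_disc (a2 + h1\<^sup>2) (a4 + 2 * h1 * h3) (a6 + h3\<^sup>2)"
    using cubic_disc_shift[of "a2 + h1\<^sup>2" x0 "a4 + 2 * h1 * h3" "a6 + h3\<^sup>2"]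
    unfolding a_def b_def c .
  have disc: "cubic_disc a b (v\<^sup>2) \<noteq> 0"
    unfolding eq by (rule disc0)
  \<comment> \<open>The quartic whose roots are the tangent slopes at the halves of
    \<open>P\<close>.\<close>
  define g where "g = [:a\<^sup>2 - 4 * b, - 8 * v, - 2 * a, 0, 1:]"
  obtain L R where L: "finite_field_extension (range to_ac) L" "extension_degree (range to_ac) L < 4"
    and R: "R \<in> points_over (map_curve to_ac E) L"
      "point_add (map_curve to_ac E) R R = map_point to_ac P"
    using assms(5) unfolding magnified_by_doubling_def by blast
  have K_L: "to_ac k \<in> L" for k
    using L(1) by (auto simp: finite_field_extension_def)
  obtain m where m: "m \<in> L" "ev to_ac m g = 0"
  proof -
    obtain xr yr where R': "R = Affine xr yr"
      using R(2) by (cases R) (auto simp: P)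
    have in_L: "xr \<in> L" "yr \<in> L" using R(1) by (auto simp: points_over_def R')
    let ?h1 = "to_ac h1" and ?h3 = "to_ac h3" and ?a2 = "to_ac a2" and ?a4 = "to_ac a4"
    define z w where "z = xr - to_ac x0" and "w = yr + ?h1 * xr + ?h3"
    define m0 where "m0 = (3 * xr\<^sup>2 + 2 * ?a2 * xr + ?a4 - 2 * ?h1 * yr) / (2 * yr + 2 * ?h1 * xr + 2 * ?h3)"
    \<comment> \<open>Completing the square adds \<open>h1 x\<close> to the ordinate and thus
      \<open>h1\<close> to every slope.\<close>
    define m where "m = m0 + ?h1"
    have not0: "yr + yr + 2 * ?h1 * xr + 2 * ?h3 \<noteq> 0"
      using R(2) by (auto simp: E R' P)
    hence nz: "2 * yr + 2 * ?h1 * xr + 2 * ?h3 \<noteq> 0" by simp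
    define x3 where "x3 = m0\<^sup>2 + 2 * ?h1 * m0 - ?a2 - xr - xr"
    have "point_add (map_curve to_ac E) R R =
        Affine x3 (- (yr + m0 * (x3 - xr)) - 2 * ?h1 * x3 - 2 * ?h3)"
      using not0 by (simp add: E R' Let_def m0_def x3_def)
    hence xP: "x3 = to_ac x0" and yP: "- (yr + m0 * (x3 - xr)) - 2 * ?h1 * x3 - 2 * ?h3 = to_ac y0"
      by (simp_all only: R(2) P point.map point.inject)
    have m0: "m0 * (2 * yr + 2 * ?h1 * xr + 2 * ?h3) = 3 * xr\<^sup>2 + 2 * ?a2 * xr + ?a4 - 2 * ?h1 * yr"
      using nz by (simp add: m0_def)
    have "2 * w * m = 3 * z\<^sup>2 + 2 * to_ac a * z + to_ac b"
      using m0 by (simp add: w_def m_def z_def a_def b_def) Groebner_Basis.algebra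
    moreover have "m\<^sup>2 - to_ac a - 2 * z = 0"
      using xP unfolding x3_def
      by (simp add: m_def z_def a_def algebra_simps power2_eq_square)
    moreover have "w = m * z - to_ac v"
      using yP[unfolded xP, symmetric] by (simp add: w_def m_def z_def v_def algebra_simps)
    ultimately have
      "m ^ 4 - 2 * to_ac a * m\<^sup>2 - 8 * to_ac v * m + (to_ac a)\<^sup>2 - 4 * to_ac b = 0"
      by (rule tangent_slope_quartic)
    hence "ev to_ac m g = 0"
      by (simp add: g_def algebra_simps eval_nat_numeral)
    moreover have "m \<in> L"
    proof -
      have "subfield L ring_of_type_algebra" using L(1) by (simp add: finite_field_extension_def)
      note cl = subfield_type_algebraD[OF this]
      have num: "numeral n \<in> L" for n using K_L[of "numeral n"] by simp
      show ?thesis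
        unfolding m_def m0_def by (intro cl in_L K_L num)
    qed
    ultimately show thesis using that by blast
  qed
  obtain p where p: "p \<noteq> 0" "Polynomial.degree p \<le> extension_degree (range to_ac) L" "ev to_ac m p = 0"
    using annihilating_poly[OF L(1) m(1)] by blast
  have "Polynomial.degree g = 4" by (simp add: g_def)
  moreover have "Polynomial.degree p < 4" using p(2) L(2) by simp
  ultimately consider k where "poly g k = 0"
    | q r where "Polynomial.degree q = 2" "Polynomial.degree r = 2" "g = q * r"
    using reducible_quartic[OF _ m(2) p(1) _ p(3)] by blast
  thus ?thesis
  proof cases
    case 1
    hence k: "k ^ 4 - 2 * a * k\<^sup>2 - 8 * v * k + a\<^sup>2 - 4 * b = 0"
      by (simp add: g_def algebra_simps eval_nat_numeral)
    define z where "z = (k\<^sup>2 - a) / 2"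
    define w where "w = k * z - v"
    note half = half_of_slope[OF two disc k, folded z_def, folded w_def]
    have "K_magnified (Weierstrass (2 * h1) a2 (2 * h3) a4 a6)
        (let u = k\<^sup>2 - a - 2 * z; v = - (w + k * (u - z)) in Affine (u + x0) (v - h1 * (u + x0) - h3))"
      using K_magnified_by_doubling[of a2 h1 x0 a4 h3 a6 w z k, folded a_def b_def, unfolded c]
        two disc half by blast
    \<comment> \<open>The double of \<open>(z, w)\<close> has abscissa 0 in the short form; its
      ordinate is then \<open>k * z - w = v\<close>, so it is \<open>P\<close>.\<close>
    moreover have "k\<^sup>2 - a - 2 * z = 0" using two by (simp add: z_def)
    ultimately show ?thesis
      by (simp add: E P w_def v_def Let_def)
  next
    case 2
    obtain s t p where st: "t + s - p\<^sup>2 = - 2 * a" "p * (t - s) = - 8 * v" "s * t = a\<^sup>2 - 4 * b"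
      using monic_quadratic_factors[OF 2(1,2)] 2(3) unfolding g_def by metis
    define \<rho> where "\<rho> = p / 2"
    have p: "p = 2 * \<rho>" using two by (simp add: \<rho>_def)
    have four: "(4::'k) \<noteq> 0" using two mult_eq_0_iff[of 2 "2::'k"] by simp
    have eight: "(8::'k) \<noteq> 0" using two four mult_eq_0_iff[of 2 "4::'k"] by simp
    have \<rho>: "\<rho> \<noteq> 0" using st(2) v0 eight by (auto simp: p)
    \<comment> \<open>The candidate abscissa of a 2-torsion point, at distance
      \<open>\<rho>\<^sup>2\<close> from that of \<open>P\<close>.\<close>
    define e where "e = x0 - \<rho>\<^sup>2"
    define A where "A = a2 + h1\<^sup>2 + 3 * e"
    define B where "B = a4 + 2 * h1 * h3 + 2 * e * (a2 + h1\<^sup>2) + 3 * e\<^sup>2"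
    have A: "A = a - 3 * \<rho>\<^sup>2" by (simp add: A_def a_def e_def)
    have B: "B = b - 2 * \<rho>\<^sup>2 * a + 3 * \<rho> ^ 4"
      by (simp add: B_def b_def a_def e_def algebra_simps eval_nat_numeral)
    \<comment> \<open>\<open>-\<rho>\<^sup>2\<close> is a root of the resolvent cubic of the quartic, which is the cubic of the curve.\<close>
    have "64 * (a * \<rho> ^ 4 - \<rho> ^ 6 - b * \<rho>\<^sup>2 + v\<^sup>2) = 0"
    proof -
      \<comment> \<open>The factorisation gives the sum, difference and product of \<open>s\<close>
        and \<open>t\<close>; this identity eliminates both.\<close>
      have "\<rho>\<^sup>2 * ((t + s)\<^sup>2 - 4 * (s * t)) = (\<rho> * (t - s))\<^sup>2"
        by Groebner_Basis.algebra
      moreover have "t + s = 4 * \<rho>\<^sup>2 - 2 * a" using st(1) by (simp add: p algebra_simps power2_eq_square)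
      moreover have "2 * (\<rho> * (t - s)) = 2 * (- 4 * v)" using st(2) by (simp add: p mult.assoc)
      hence "\<rho> * (t - s) = - 4 * v" by (simp only: mult_left_cancel[OF two])
      ultimately have "\<rho>\<^sup>2 * ((4 * \<rho>\<^sup>2 - 2 * a)\<^sup>2 - 4 * (a\<^sup>2 - 4 * b)) = (- 4 * v)\<^sup>2"
        using st(3) by simp
      thus ?thesis by Groebner_Basis.algebra
    qed
    moreover have "(64::'k) \<noteq> 0" using eight mult_eq_0_iff[of 8 "8::'k"] by simp
    ultimately have root: "a * \<rho> ^ 4 - \<rho> ^ 6 - b * \<rho>\<^sup>2 + v\<^sup>2 = 0"
      by (simp only: mult_eq_0_iff simp_thms)
    \<comment> \<open>The short form shifted by \<open>e\<close> has zero constant term, so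
      \<open>e\<close> is the abscissa of a 2-torsion point.\<close>
    have C: "a6 + h3\<^sup>2 + e * (a4 + 2 * h1 * h3) + e\<^sup>2 * (a2 + h1\<^sup>2) + e ^ 3 = 0"
      using root c unfolding e_def a_def b_def by Groebner_Basis.algebra
    have eq': "cubic_disc A B 0 = cubic_disc (a2 + h1\<^sup>2) (a4 + 2 * h1 * h3) (a6 + h3\<^sup>2)"
      using cubic_disc_shift[of "a2 + h1\<^sup>2" e "a4 + 2 * h1 * h3" "a6 + h3\<^sup>2"]
      unfolding A_def B_def C .
    have "cubic_disc A B 0 \<noteq> 0"
      unfolding eq' by (rule disc0)
    moreover have "cubic_disc A B 0 = B\<^sup>2 * (A\<^sup>2 - 4 * B)"
      by (simp add: algebra_simps power2_eq_square power3_eq_cube)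
    ultimately have "B \<noteq> 0" "A\<^sup>2 - 4 * B \<noteq> 0" by auto
    moreover have "v\<^sup>2 = (\<rho>\<^sup>2) ^ 3 + A * (\<rho>\<^sup>2)\<^sup>2 + B * \<rho>\<^sup>2"
      using root unfolding A B by Groebner_Basis.algebra
    ultimately have "K_magnified (Weierstrass (2 * h1) a2 (2 * h3) a4 a6)
        (Affine (\<rho>\<^sup>2 + e) (v - h1 * (\<rho>\<^sup>2 + e) - h3))"
      using K_magnified_by_two_isogeny[of a4 h1 h3 e a2 a6 v \<rho>, folded A_def B_def] two C \<rho> by blast
    thus ?thesis by (simp add: E P e_def v_def)
  qed
qed

end
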